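(* Let $A$ and $B$ be two bounded operators acting on a complex Hilbert space $H$ such that $A$ is normal and $\|B\|=1$. Let $n\in\mathbb{N}$, put $\Gamma=\{(x,y,z)\in\mathbb{C}^3: x^n+y^n+(-1)^{n-1}z^n=1\}$, and $\tau_{1j}=(e^{2\pi ji/n},0,0)$, $\tau_{2j}=(0,e^{2\pi ji/n},0)$, $j=0,\dots,n-1$. Suppose that there exists $\epsilon>0$ such that: a) $\sigma_p(A,B,AB)\cap\Delta_3(\tau_{mj},\epsilon)=\Gamma\cap\Delta_3(\tau_{mj},\epsilon)$ for $m=1,2$, $j=0,\dots,n-1$; b) each point of $\sigma_p(A,B,AB)\cap\Delta_3(\tau_{mj},\epsilon)$ ($m=1,2$, $j=0,\dots,n-1$) has multiplicity one. Then: 1) The $n$-dimensional subspace $L$ of $H$ spanned by the $A$-eigenvectors with eigenvalues $e^{2\pi mi/n}$, $m=0,\dots,n-1$, is invariant under the action of $B$. 2) The restriction of $B$ to $L$ is unitary (and, obviously, this is true for $A$).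
   Context: For bounded operators $A_1,\dots,A_k$ on $H$, $\sigma_p(A_1,\dots,A_k)=\{(x_1,\dots,x_k)\in\mathbb{C}^k: x_1A_1+\dots+x_kA_k-I \text{ is not invertible}\}$. $\Delta_k(x,\rho)=\{w\in\mathbb{C}^k: |w_j-x_j|<\rho,\ j=1,\dots,k\}$ is the polydisk. Multiplicity one: a point $x\in\sigma_p(A_1,\dots,A_k)$ has multiplicity one if $1$ is an isolated point of the spectrum of $A(x)=x_1A_1+\dots+x_kA_k$ and the Riesz projection $\frac{1}{2\pi i}\int_{|w-1|=\rho}(w-A(x))^{-1}dw$ (for small $\rho>0$) has rank one. *)

theory Defs
  imports "HOL-Complex_Analysis.Complex_Analysis"
begin

section \<open>Complex Hilbert spaces\<close>

text \<open>
  A complex Hilbert space is a complete real inner product space together with a compatible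
  complex scalar multiplication and a complex inner product (linear in the first argument) whose
  real part is the real inner product. In particular the norm is the square root of
  \<open>cinner x x\<close>. No separability or dimension restriction is imposed.
\<close>

class chilbert_space = real_inner + banach +
  fixes scaleC :: "complex \<Rightarrow> 'a \<Rightarrow> 'a"  (infixr "*\<^sub>C" 75)
    and cinner :: "'a \<Rightarrow> 'a \<Rightarrow> complex"
  assumes scaleC_add_right: "c *\<^sub>C (x + y) = c *\<^sub>C x + c *\<^sub>C y"
    and scaleC_add_left: "(c + d) *\<^sub>C x = c *\<^sub>C x + d *\<^sub>C x"
    and scaleC_scaleC: "c *\<^sub>C d *\<^sub>C x = (c * d) *\<^sub>C x"
    and scaleR_scaleC: "r *\<^sub>R x = complex_of_real r *\<^sub>C x"
    and cinner_commute: "cinner x y = cnj (cinner y x)"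
    and cinner_add_left: "cinner (x + y) z = cinner x z + cinner y z"
    and cinner_scaleC_left: "cinner (c *\<^sub>C x) y = c * cinner x y"
    and Re_cinner: "Re (cinner x y) = inner x y"

instantiation complex :: chilbert_space
begin

definition scaleC_complex :: "complex \<Rightarrow> complex \<Rightarrow> complex"
  where "scaleC_complex c x = c * x"

definition cinner_complex :: "complex \<Rightarrow> complex \<Rightarrow> complex"
  where "cinner_complex x y = x * cnj y"

instance
  by standard
    (auto simp: scaleC_complex_def cinner_complex_def algebra_simps scaleR_conv_of_real
      inner_complex_def)

end

lemma scaleC_one: "1 *\<^sub>C x = (x :: 'a::chilbert_space)"
  using scaleR_scaleC[of 1 x] by simp

global_interpretation complex_vector: vector_space "scaleC :: complex \<Rightarrow> 'a \<Rightarrow> 'a::chilbert_space"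
  by unfold_locales (simp_all add: scaleC_add_right scaleC_add_left scaleC_scaleC scaleC_one)

lemma norm_scaleC: "norm (c *\<^sub>C x) = cmod c * norm (x :: 'a::chilbert_space)"
proof -
  have Im0: "Im (cinner x x) = 0"
    using cinner_commute[of x x] by (metis Reals_cnj_iff complex_is_Real_iff)
  have "cinner (c *\<^sub>C x) (c *\<^sub>C x) = c * cnj (c * cinner x x)"
    by (metis cinner_commute cinner_scaleC_left)
  also have "\<dots> = (c * cnj c) * cinner x x"
    using Im0 by (simp add: complex_eq_iff algebra_simps)
  also have "\<dots> = complex_of_real ((cmod c)\<^sup>2) * cinner x x"
    by (simp only: complex_norm_square)
  finally have "inner (c *\<^sub>C x) (c *\<^sub>C x) = (cmod c)\<^sup>2 * inner x x"
    by (simp flip: Re_cinner)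
  then show ?thesis
    by (simp add: norm_eq_sqrt_inner real_sqrt_mult)
qed

section \<open>Bounded complex-linear operators\<close>

text \<open>
  Bounded operators on a complex Hilbert space are the elements \<open>T\<close> of the Banach space
  \<open>'a \<Rightarrow>\<^sub>L 'a\<close> of bounded real-linear maps that satisfy \<open>clinear_op T\<close>. The norm of this
  type is the operator norm.
\<close>

definition clinear_op :: "('a::chilbert_space \<Rightarrow>\<^sub>L 'a) \<Rightarrow> bool"
  where "clinear_op T \<longleftrightarrow> Vector_Spaces.linear scaleC scaleC (blinfun_apply T)"

lift_definition scaleC_op :: "complex \<Rightarrow> ('a::chilbert_space \<Rightarrow>\<^sub>L 'a) \<Rightarrow> ('a \<Rightarrow>\<^sub>L 'a)"
    (infixr "*\<^sub>O" 75)
  is "\<lambda>c f x. c *\<^sub>C f x"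
proof -
  fix c :: complex and f :: "'a \<Rightarrow> 'a"
  assume "bounded_linear f"
  moreover have "bounded_linear (\<lambda>x::'a. c *\<^sub>C x)"
  proof (rule bounded_linear_intro[where K = "cmod c"])
    fix r :: real and x :: 'a
    show "c *\<^sub>C r *\<^sub>R x = r *\<^sub>R c *\<^sub>C x"
      by (simp add: scaleR_scaleC scaleC_scaleC mult.commute)
  qed (simp_all add: scaleC_add_right norm_scaleC mult.commute)
  ultimately show "bounded_linear (\<lambda>x. c *\<^sub>C f x)"
    by (rule bounded_linear_compose[rotated])
qed

lemma scaleC_op_apply [simp]: "blinfun_apply (c *\<^sub>O T) x = c *\<^sub>C blinfun_apply T x"
  by transfer simp

definition is_adjoint :: "('a::chilbert_space \<Rightarrow>\<^sub>L 'a) \<Rightarrow> ('a \<Rightarrow>\<^sub>L 'a) \<Rightarrow> bool"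
  where "is_adjoint S T \<longleftrightarrow> (\<forall>x y. cinner (blinfun_apply T x) y = cinner x (blinfun_apply S y))"

lemma is_adjoint_unique:
  assumes "is_adjoint S T" "is_adjoint S' T"
  shows "S = S'"
proof (rule blinfun_eqI)
  fix y
  have "inner x (blinfun_apply S y) = inner x (blinfun_apply S' y)" for x
    using assms by (metis is_adjoint_def Re_cinner)
  then show "blinfun_apply S y = blinfun_apply S' y"
    by (metis inner_commute vector_eq_rdot)
qed

text \<open>Normality: \<open>T\<close> commutes with its (unique) adjoint.\<close>

definition normal_op :: "('a::chilbert_space \<Rightarrow>\<^sub>L 'a) \<Rightarrow> bool"
  where "normal_op T \<longleftrightarrow> (\<exists>S. is_adjoint S T \<and> T o\<^sub>L S = S o\<^sub>L T)"

definition invertible_op :: "('a::chilbert_space \<Rightarrow>\<^sub>L 'a) \<Rightarrow> bool"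
  where "invertible_op T \<longleftrightarrow>
    (\<exists>S. clinear_op S \<and> T o\<^sub>L S = id_blinfun \<and> S o\<^sub>L T = id_blinfun)"

definition inverse_op :: "('a::chilbert_space \<Rightarrow>\<^sub>L 'a) \<Rightarrow> ('a \<Rightarrow>\<^sub>L 'a)"
  where "inverse_op T = (THE S. T o\<^sub>L S = id_blinfun \<and> S o\<^sub>L T = id_blinfun)"

lemma inverse_op_eqI:
  assumes "T o\<^sub>L S = id_blinfun" "S o\<^sub>L T = id_blinfun"
  shows "inverse_op T = S"
  unfolding inverse_op_def
proof (rule the_equality)
  fix R assume R: "T o\<^sub>L R = id_blinfun \<and> R o\<^sub>L T = id_blinfun"
  show "R = S"
  proof (rule blinfun_eqI)
    fix x
    have "blinfun_apply R x = blinfun_apply (R o\<^sub>L T) (blinfun_apply S x)"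
      using assms(1) by (metis blinfun_apply_blinfun_compose id_blinfun.rep_eq id_apply)
    then show "blinfun_apply R x = blinfun_apply S x"
      using R by simp
  qed
qed (use assms in simp)

definition spectrum_op :: "('a::chilbert_space \<Rightarrow>\<^sub>L 'a) \<Rightarrow> complex set"
  where "spectrum_op T = {w. \<not> invertible_op (w *\<^sub>O id_blinfun - T)}"

definition eigenvectors :: "('a::chilbert_space \<Rightarrow>\<^sub>L 'a) \<Rightarrow> complex \<Rightarrow> 'a set"
  where "eigenvectors T c = {v. v \<noteq> 0 \<and> blinfun_apply T v = c *\<^sub>C v}"

text \<open>The restriction of \<open>T\<close> to the subspace \<open>L\<close> is a surjective isometry of \<open>L\<close>.\<close>

definition unitary_on :: "'a::chilbert_space set \<Rightarrow> ('a \<Rightarrow>\<^sub>L 'a) \<Rightarrow> bool"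
  where "unitary_on L T \<longleftrightarrow> blinfun_apply T ` L = L \<and>
    (\<forall>u\<in>L. \<forall>v\<in>L. cinner (blinfun_apply T u) (blinfun_apply T v) = cinner u v)"

text \<open>
  The operator-valued analogue of \<open>contour_integral\<close>; the integral is taken in the Banach
  space of operators.
\<close>

definition contour_integral_op ::
    "(real \<Rightarrow> complex) \<Rightarrow> (complex \<Rightarrow> ('a::chilbert_space \<Rightarrow>\<^sub>L 'a)) \<Rightarrow> ('a \<Rightarrow>\<^sub>L 'a)"
  where "contour_integral_op g F =
    integral {0..1} (\<lambda>t. vector_derivative g (at t within {0..1}) *\<^sub>O F (g t))"

definition riesz_projection ::
    "('a::chilbert_space \<Rightarrow>\<^sub>L 'a) \<Rightarrow> complex \<Rightarrow> real \<Rightarrow> ('a \<Rightarrow>\<^sub>L 'a)"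
  where "riesz_projection T c \<rho> = (1 / (2 * of_real pi * \<i>)) *\<^sub>O
    contour_integral_op (circlepath c \<rho>) (\<lambda>w. inverse_op (w *\<^sub>O id_blinfun - T))"

section \<open>The joint spectrum of a tuple of operators\<close>

definition pencil :: "('a::chilbert_space \<Rightarrow>\<^sub>L 'a) ^ 'k \<Rightarrow> complex ^ 'k \<Rightarrow> ('a \<Rightarrow>\<^sub>L 'a)"
  where "pencil As x = (\<Sum>j\<in>UNIV. x $ j *\<^sub>O As $ j)"

definition sigma_p :: "('a::chilbert_space \<Rightarrow>\<^sub>L 'a) ^ 'k \<Rightarrow> (complex ^ 'k) set"
  where "sigma_p As = {x. \<not> invertible_op (pencil As x - id_blinfun)}"

definition polydisk :: "complex ^ 'k \<Rightarrow> real \<Rightarrow> (complex ^ 'k) set"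
  where "polydisk x \<rho> = {w. \<forall>j. cmod (w $ j - x $ j) < \<rho>}"

definition multiplicity_one :: "('a::chilbert_space \<Rightarrow>\<^sub>L 'a) ^ 'k \<Rightarrow> complex ^ 'k \<Rightarrow> bool"
  where "multiplicity_one As x \<longleftrightarrow>
    1 isolated_in spectrum_op (pencil As x) \<and>
    (\<forall>\<^sub>F \<rho> in at_right 0.
       complex_vector.dim (range (blinfun_apply (riesz_projection (pencil As x) 1 \<rho>))) = 1)"

definition root_of_unity :: "nat \<Rightarrow> nat \<Rightarrow> complex"
  where "root_of_unity n j = exp (2 * of_real pi * of_nat j * \<i> / of_nat n)"

definition Gamma_surface :: "nat \<Rightarrow> (complex ^ 3) set"
  where "Gamma_surface n =
    {p. (p $ 1) ^ n + (p $ 2) ^ n + (- 1) ^ (n - 1) * (p $ 3) ^ n = 1}"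

definition tau1 :: "nat \<Rightarrow> nat \<Rightarrow> complex ^ 3"
  where "tau1 n j = vector [root_of_unity n j, 0, 0]"

definition tau2 :: "nat \<Rightarrow> nat \<Rightarrow> complex ^ 3"
  where "tau2 n j = vector [0, root_of_unity n j, 0]"

end

theory Submission
  imports Defs
begin

text \<open>
  Let \<open>U\<close> be the set of \<open>n\<close>-th roots of unity. Multiplicity one at the points \<open>\<tau>\<^sub>1\<^sub>j\<close> means that
  each \<open>z \<in> U\<close> is an isolated spectral point of \<open>A\<close> with a rank one Riesz projection; as \<open>A\<close> is normal,
  this projection is the orthogonal projection onto a unit eigenvector \<open>e z\<close>, and the resolvent of
  \<open>A\<close> has a bounded reduced part \<open>S\<close> at \<open>z\<close> (\<open>normal_simple_spectral_point\<close>).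

  The heart of the matter is that \<open>B\<^sup>n e z = e z\<close> (\<open>power_fixes_simple_eigenvector\<close>). After rescaling,
  let \<open>T = A / z\<close>, so that \<open>T e = e\<close>. The surface contains the line \<open>(1, y, - y)\<close>, on which the pencil
  factors as \<open>(T - I) (I - y B)\<close>. Moving off this line along the surface and expanding to first order,
  singularity of the pencil forces \<open>\<langle>B v, e\<rangle> = y\<^bsup>n-1\<^esup> \<langle>v, e\<rangle>\<close> for \<open>v = (I - y B)\<^sup>-\<^sup>1 e\<close>
  (\<open>resolvent_relation_at_simple_eigenvalue\<close>). This determines the moments \<open>\<langle>B\<^sup>k e, e\<rangle>\<close>, in particular
  \<open>\<langle>B\<^sup>n e, e\<rangle> = 1\<close>, and \<open>\<parallel>B\<parallel> = 1\<close> leaves only \<open>B\<^sup>n e = e\<close>.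

  Averaging the vectors \<open>B\<^sup>i e z\<close> against the characters of the cyclic group splits \<open>e z\<close> into
  eigenvectors of \<open>B\<close> with eigenvalues in \<open>U\<close>. Multiplicity one at the points \<open>\<tau>\<^sub>2\<^sub>j\<close> says that these
  eigenspaces of \<open>B\<close> are lines, so all \<open>e z\<close> lie in one and the same \<open>n\<close>-dimensional space spanned by
  eigenvectors of \<open>B\<close>. That space is therefore \<open>L\<close>, and it is invariant under \<open>B\<close>
  (\<open>span_of_cyclic_eigenvectors\<close>). On it \<open>B\<close> is a contraction of finite order, hence
  unitary, and \<open>A\<close> is normal with unimodular eigenvalues.
\<close>

section \<open>Complex inner products and complex-linear operators\<close>

lemma cinner_add_right: "cinner x (y + z) = cinner x y + cinner (x :: 'a::chilbert_space) z"
  by (metis cinner_add_left cinner_commute complex_cnj_add)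

lemma cinner_scaleC_right: "cinner x (c *\<^sub>C y) = cnj c * cinner (x :: 'a::chilbert_space) y"
  by (metis cinner_commute cinner_scaleC_left complex_cnj_mult)

lemma cinner_zero_left [simp]: "cinner 0 (x :: 'a::chilbert_space) = 0"
  using cinner_add_left[of 0 0 x] by simp

lemma cinner_minus_left: "cinner (- x) y = - cinner (x :: 'a::chilbert_space) y"
  using cinner_add_left[of "- x" x y] by (simp add: eq_neg_iff_add_eq_0)

lemma cinner_diff_left: "cinner (x - y) z = cinner x z - cinner (y :: 'a::chilbert_space) z"
  using cinner_add_left[of x "- y" z] by (simp add: cinner_minus_left)

lemma cinner_self: "cinner x x = complex_of_real ((norm (x :: 'a::chilbert_space))\<^sup>2)"
proof -
  have "Im (cinner x x) = 0"
    using cinner_commute[of x x] by (metis Reals_cnj_iff complex_is_Real_iff)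
  then show ?thesis
    by (simp add: complex_eq_iff Re_cinner power2_norm_eq_inner)
qed

lemma norm_cinner_le: "cmod (cinner x y) \<le> norm x * norm (y :: 'a::chilbert_space)"
proof (cases "cinner x y = 0")
  case False
  \<comment> \<open>The phase \<open>c\<close> rotates the inner product onto the positive real axis, which reduces the claim to
    the real Cauchy-Schwarz inequality.\<close>
  define c where "c = cnj (cinner x y) / cmod (cinner x y)"
  have c: "cmod c = 1" using False by (simp add: c_def norm_divide)
  have "c * cinner x y = cmod (cinner x y)"
    using False
    by (simp add: c_def field_simps power2_eq_square flip: complex_norm_square of_real_mult)
  then have "cmod (cinner x y) = Re (cinner (c *\<^sub>C x) y)"
    by (simp add: cinner_scaleC_left)
  also have "\<dots> \<le> norm (c *\<^sub>C x) * norm y"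
    by (simp add: Re_cinner norm_cauchy_schwarz)
  finally show ?thesis by (simp add: norm_scaleC c)
qed auto

lemma cinner_right_eqI:
  assumes "\<And>x. cinner x y = cinner x (z :: 'a::chilbert_space)"
  shows "y = z"
proof -
  have "inner x y = inner x z" for x using assms by (metis Re_cinner)
  then show ?thesis by (metis inner_commute vector_eq_rdot)
qed

lemma clinear_op_iff:
  "clinear_op T \<longleftrightarrow> (\<forall>c x. blinfun_apply T (c *\<^sub>C x) = c *\<^sub>C blinfun_apply T x)"
  unfolding clinear_op_def Vector_Spaces.linear_iff
  by (auto simp: blinfun.add_right complex_vector.vector_space_axioms)

lemma clinear_opD: "clinear_op T \<Longrightarrow> blinfun_apply T (c *\<^sub>C x) = c *\<^sub>C blinfun_apply T x"
  by (simp add: clinear_op_iff)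

lemma clinear_op_id: "clinear_op id_blinfun"
  by (simp add: clinear_op_iff)

lemma clinear_op_compose: "clinear_op S \<Longrightarrow> clinear_op T \<Longrightarrow> clinear_op (S o\<^sub>L T)"
  by (simp add: clinear_op_iff)

lemma clinear_op_add: "clinear_op S \<Longrightarrow> clinear_op T \<Longrightarrow> clinear_op (S + T)"
  by (simp add: clinear_op_iff blinfun.add_left scaleC_add_right)

lemma clinear_op_diff: "clinear_op S \<Longrightarrow> clinear_op T \<Longrightarrow> clinear_op (S - T)"
  by (simp add: clinear_op_iff blinfun.diff_left complex_vector.scale_right_diff_distrib)

lemma clinear_op_scaleC: "clinear_op T \<Longrightarrow> clinear_op (c *\<^sub>O T)"
  by (simp add: clinear_op_iff scaleC_scaleC mult.commute)

lemmas clinear_op_intros =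
  clinear_op_id clinear_op_compose clinear_op_add clinear_op_diff clinear_op_scaleC

lemma norm_scaleC_op: "norm (c *\<^sub>O T) \<le> cmod c * norm T"
  by (rule norm_blinfun_bound) (auto simp: norm_scaleC norm_blinfun mult_left_mono mult.assoc)

lemma bounded_bilinear_scaleC_op: "bounded_bilinear scaleC_op"
proof
  show "\<exists>K. \<forall>a b. norm (a *\<^sub>O b :: 'a \<Rightarrow>\<^sub>L 'a) \<le> norm a * norm b * K"
    by (rule exI[of _ 1]) (use norm_scaleC_op in auto)
next
  show "(r *\<^sub>R c) *\<^sub>O T = r *\<^sub>R c *\<^sub>O T" for r c and T :: "'a \<Rightarrow>\<^sub>L 'a"
    by (rule blinfun_eqI)
      (simp add: blinfun.bilinear_simps scaleR_scaleC[where 'a = 'a] scaleC_scaleC scaleR_conv_of_real)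
next
  show "c *\<^sub>O r *\<^sub>R T = r *\<^sub>R c *\<^sub>O T" for r c and T :: "'a \<Rightarrow>\<^sub>L 'a"
    by (rule blinfun_eqI)
      (simp add: blinfun.bilinear_simps scaleR_scaleC[where 'a = 'a] scaleC_scaleC mult.commute)
qed (auto intro!: blinfun_eqI simp: blinfun.bilinear_simps scaleC_add_left scaleC_add_right)

lemma clinear_op_adjoint:
  fixes T Q :: "'a::chilbert_space \<Rightarrow>\<^sub>L 'a"
  assumes "is_adjoint Q T"
  shows "clinear_op Q"
proof -
  have "blinfun_apply Q (c *\<^sub>C x) = c *\<^sub>C blinfun_apply Q x" for c x
  proof (rule cinner_right_eqI)
    fix y
    have "cinner y (blinfun_apply Q z) = cinner (blinfun_apply T y) z" for z
      using assms by (simp add: is_adjoint_def)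
    then show "cinner y (blinfun_apply Q (c *\<^sub>C x)) = cinner y (c *\<^sub>C blinfun_apply Q x)"
      by (simp add: cinner_scaleC_right)
  qed
  then show ?thesis by (simp add: clinear_op_iff)
qed

lemma normal_op_scaleC:
  fixes T :: "'a::chilbert_space \<Rightarrow>\<^sub>L 'a"
  assumes T: "clinear_op T" and "normal_op T"
  shows "normal_op (c *\<^sub>O T)"
proof -
  obtain Q where Q: "is_adjoint Q T" "T o\<^sub>L Q = Q o\<^sub>L T"
    using \<open>normal_op T\<close> unfolding normal_op_def by blast
  have adj: "cinner x (blinfun_apply Q y) = cinner (blinfun_apply T x) y" for x y
    using Q(1) by (simp add: is_adjoint_def)
  have "blinfun_apply T (blinfun_apply Q x) = blinfun_apply Q (blinfun_apply T x)" for x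
    using Q(2) by (metis blinfun_apply_blinfun_compose)
  then have "(c *\<^sub>O T) o\<^sub>L (cnj c *\<^sub>O Q) = (cnj c *\<^sub>O Q) o\<^sub>L (c *\<^sub>O T)"
    by (intro blinfun_eqI) (simp add: clinear_opD[OF T] clinear_opD[OF clinear_op_adjoint[OF Q(1)]] scaleC_scaleC mult.commute)
  moreover have "is_adjoint (cnj c *\<^sub>O Q) (c *\<^sub>O T)"
    by (simp add: is_adjoint_def cinner_scaleC_left cinner_scaleC_right adj)
  ultimately show ?thesis unfolding normal_op_def by blast
qed

section \<open>Criteria for invertibility\<close>

lemma invertible_opE:
  assumes "invertible_op T"
  obtains S where "clinear_op S" "\<And>x. blinfun_apply T (blinfun_apply S x) = x"
    "\<And>x. blinfun_apply S (blinfun_apply T x) = x" "T o\<^sub>L S = id_blinfun" "S o\<^sub>L T = id_blinfun"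
proof -
  obtain S where S: "clinear_op S" "T o\<^sub>L S = id_blinfun" "S o\<^sub>L T = id_blinfun"
    using assms unfolding invertible_op_def by blast
  have "blinfun_apply (T o\<^sub>L S) x = x" "blinfun_apply (S o\<^sub>L T) x = x" for x
    by (simp_all only: S id_blinfun.rep_eq id_apply)
  then show thesis by (intro that[OF S(1) _ _ S(2,3)]) simp_all
qed

lemma invertible_opI:
  assumes "clinear_op S" "\<And>x. blinfun_apply T (blinfun_apply S x) = x"
    "\<And>x. blinfun_apply S (blinfun_apply T x) = x"
  shows "invertible_op T"
  unfolding invertible_op_def
  by (rule exI[of _ S]) (use assms in \<open>auto intro!: blinfun_eqI\<close>)

text \<open>
  A linear bijection whose solutions obey a norm bound is invertible, so exhibiting bounded
  solutions of \<open>K v = f\<close> replaces an appeal to the open mapping theorem.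
\<close>
lemma invertible_opI_bounded_solution:
  fixes K :: "'a::chilbert_space \<Rightarrow>\<^sub>L 'a"
  assumes lin: "clinear_op K"
    and inj: "\<And>v. blinfun_apply K v = 0 \<Longrightarrow> v = 0"
    and sol: "\<And>f. \<exists>v. blinfun_apply K v = f \<and> norm v \<le> M * norm f"
  shows "invertible_op K"
proof -
  obtain R where R: "\<And>f. blinfun_apply K (R f) = f" "\<And>f. norm (R f) \<le> M * norm f"
    using sol by metis
  have uniq: "u = v" if "blinfun_apply K u = blinfun_apply K v" for u v
    using inj[of "u - v"] that by (simp add: blinfun.diff_right)
  have add: "R (f + g) = R f + R g" for f g
    by (rule uniq) (simp add: R blinfun.add_right)
  have scC: "R (c *\<^sub>C f) = c *\<^sub>C R f" for c f
    by (rule uniq) (simp add: R clinear_opD[OF lin])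
  have bl: "bounded_linear R"
    by (rule bounded_linear_intro[where K = M])
      (use R in \<open>auto simp: add scaleR_scaleC scC mult.commute\<close>)
  show ?thesis
  proof (rule invertible_opI[of "Blinfun R"])
    show "clinear_op (Blinfun R)"
      by (simp add: clinear_op_iff bounded_linear_Blinfun_apply[OF bl] scC)
  qed (auto simp: bounded_linear_Blinfun_apply[OF bl] R intro: uniq)
qed

lemma invertible_op_compose:
  assumes "invertible_op S" "invertible_op T"
  shows "invertible_op (S o\<^sub>L T)"
proof -
  obtain S' where S: "clinear_op S'" "\<And>x. blinfun_apply S (blinfun_apply S' x) = x"
    "\<And>x. blinfun_apply S' (blinfun_apply S x) = x"
    using invertible_opE[OF assms(1)] by metis
  obtain T' where T: "clinear_op T'" "\<And>x. blinfun_apply T (blinfun_apply T' x) = x"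
    "\<And>x. blinfun_apply T' (blinfun_apply T x) = x"
    using invertible_opE[OF assms(2)] by metis
  show ?thesis
    by (rule invertible_opI[of "T' o\<^sub>L S'"]) (use S T in \<open>auto intro: clinear_op_compose\<close>)
qed

text \<open>
  The equation \<open>v - X v = f\<close> is a fixed point problem for the contraction \<open>v \<mapsto> f + X v\<close>.
\<close>
lemma invertible_op_id_minus:
  fixes X :: "'a::chilbert_space \<Rightarrow>\<^sub>L 'a"
  assumes lin: "clinear_op X" and small: "norm X < 1"
  shows "invertible_op (id_blinfun - X)"
proof (rule invertible_opI_bounded_solution[where M = "1 / (1 - norm X)"])
  show "clinear_op (id_blinfun - X)" by (intro clinear_op_intros lin)
  have bd: "(1 - norm X) * norm v \<le> norm (blinfun_apply (id_blinfun - X) v)" for v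
  proof -
    have "norm v - norm (blinfun_apply X v) \<le> norm (v - blinfun_apply X v)"
      by (rule norm_triangle_ineq2)
    with norm_blinfun[of X v] show ?thesis by (simp add: blinfun.diff_left algebra_simps)
  qed
  show "v = 0" if "blinfun_apply (id_blinfun - X) v = 0" for v
    using bd[of v] that small by (simp add: mult_le_0_iff)
  show "\<exists>v. blinfun_apply (id_blinfun - X) v = f \<and> norm v \<le> 1 / (1 - norm X) * norm f" for f
  proof -
    have "\<exists>!v. f + blinfun_apply X v = v"
    proof (rule banach_fix_type[of "norm X"])
      show "\<forall>x y. dist (f + blinfun_apply X x) (f + blinfun_apply X y) \<le> norm X * dist x y"
        by (auto simp: dist_norm norm_blinfun simp flip: blinfun.diff_right)
    qed (use small in auto)
    then obtain v where v: "f + blinfun_apply X v = v" by blast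
    then have "blinfun_apply (id_blinfun - X) v = f"
      by (simp add: blinfun.diff_left algebra_simps)
    with bd[of v] small show ?thesis
      by (intro exI[of _ v]) (auto simp: field_simps)
  qed
qed

lemma invertible_op_id_minus_scaleC:
  fixes B :: "'a::chilbert_space \<Rightarrow>\<^sub>L 'a"
  assumes B: "clinear_op B" "norm B \<le> 1" and y: "cmod y < 1"
  shows "invertible_op (id_blinfun - y *\<^sub>O B)"
proof (intro invertible_op_id_minus clinear_op_scaleC B)
  have "norm (y *\<^sub>O B) \<le> cmod y * 1"
    by (rule order_trans[OF norm_scaleC_op mult_left_mono]) (use B in auto)
  then show "norm (y *\<^sub>O B) < 1" using y by simp
qed

section \<open>Simple isolated points of the spectrum\<close>

text \<open>
  By the resolvent identity \<open>R w - R a = (a - w) R w R a\<close>, the norm of \<open>R w\<close> is at most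
  \<open>2 \<parallel>R a\<parallel>\<close> for \<open>w\<close> close to \<open>a\<close>, and the same identity then gives continuity at \<open>a\<close>.
\<close>
lemma continuous_on_resolvent:
  fixes T :: "'a::chilbert_space \<Rightarrow>\<^sub>L 'a"
  assumes inv: "\<And>w. w \<in> W \<Longrightarrow> invertible_op (w *\<^sub>O id_blinfun - T)"
  shows "continuous_on W (\<lambda>w. inverse_op (w *\<^sub>O id_blinfun - T))"
proof -
  define R where "R w = inverse_op (w *\<^sub>O id_blinfun - T)" for w
  have R: "R w o\<^sub>L (w *\<^sub>O id_blinfun - T) = id_blinfun" "(w *\<^sub>O id_blinfun - T) o\<^sub>L R w = id_blinfun"
    if w: "w \<in> W" for w
    using invertible_opE[OF inv[OF w]] inverse_op_eqI unfolding R_def by metis+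
  have res: "R w - R a = (a - w) *\<^sub>O (R w o\<^sub>L R a)" if "w \<in> W" "a \<in> W" for w a
  proof -
    have "R w - R a = R w o\<^sub>L ((a *\<^sub>O id_blinfun - T) - (w *\<^sub>O id_blinfun - T)) o\<^sub>L R a"
    proof (rule blinfun_eqI)
      fix x
      have "blinfun_apply (R w o\<^sub>L (w *\<^sub>O id_blinfun - T)) (blinfun_apply (R a) x) = blinfun_apply (R a) x"
        "blinfun_apply ((a *\<^sub>O id_blinfun - T) o\<^sub>L R a) x = x"
        by (simp_all only: R that id_blinfun.rep_eq id_apply)
      then show "blinfun_apply (R w - R a) x = blinfun_apply
          (R w o\<^sub>L ((a *\<^sub>O id_blinfun - T) - (w *\<^sub>O id_blinfun - T)) o\<^sub>L R a) x"
        by (simp only: blinfun_apply_blinfun_compose blinfun.diff_left blinfun.diff_right)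
    qed
    also have "(a *\<^sub>O id_blinfun - T) - (w *\<^sub>O id_blinfun - T) = (a - w) *\<^sub>O id_blinfun"
      by (rule blinfun_eqI) (simp add: blinfun.bilinear_simps complex_vector.scale_left_diff_distrib)
    also have "R w o\<^sub>L ((a - w) *\<^sub>O id_blinfun) o\<^sub>L R a = (a - w) *\<^sub>O (R w o\<^sub>L R a)"
    proof -
      have "clinear_op (R w)"
        using invertible_opE[OF inv[OF that(1)]] inverse_op_eqI unfolding R_def by metis
      then show ?thesis
        by (intro blinfun_eqI) (simp add: clinear_opD)
    qed
    finally show ?thesis .
  qed
  have "(R \<longlongrightarrow> R a) (at a within W)" if a: "a \<in> W" for a
  proof -
    have le: "norm (R w - R a) \<le> cmod (w - a) * norm (R w) * norm (R a)" if "w \<in> W" for w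
    proof -
      have "norm (R w - R a) \<le> cmod (a - w) * norm (R w o\<^sub>L R a)"
        using res[OF that a] norm_scaleC_op by metis
      also have "\<dots> \<le> cmod (a - w) * (norm (R w) * norm (R a))"
        by (intro mult_left_mono norm_blinfun_compose) auto
      finally show ?thesis by (simp add: norm_minus_commute mult.assoc)
    qed
    have *: "norm (R w - R a) \<le> cmod (w - a) * (2 * norm (R a)) * norm (R a)"
      if "w \<in> W" "cmod (w - a) * norm (R a) \<le> 1 / 2" for w
    proof -
      have "norm (R w) \<le> norm (R a) + norm (R w - R a)"
        by (metis add.commute diff_add_cancel norm_triangle_ineq)
      also have "norm (R w - R a) \<le> (cmod (w - a) * norm (R a)) * norm (R w)"
        using le[OF that(1)] by (simp add: mult_ac)
      also have "\<dots> \<le> 1 / 2 * norm (R w)"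
        using that(2) by (intro mult_right_mono) auto
      finally have "norm (R w) \<le> 2 * norm (R a)" by simp
      then have "cmod (w - a) * norm (R w) * norm (R a) \<le> cmod (w - a) * (2 * norm (R a)) * norm (R a)"
        by (intro mult_right_mono mult_left_mono) auto
      with le[OF that(1)] show ?thesis by linarith
    qed
    have lim: "((\<lambda>w. cmod (w - a) * norm (R a)) \<longlongrightarrow> cmod (a - a) * norm (R a)) (at a within W)"
      by (intro tendsto_intros)
    then have "\<forall>\<^sub>F w in at a within W. cmod (w - a) * norm (R a) < 1 / 2"
      by (rule order_tendstoD) auto
    then have ev: "\<forall>\<^sub>F w in at a within W.
        norm (R w - R a) \<le> cmod (w - a) * (2 * norm (R a)) * norm (R a)"
      unfolding eventually_at_filter by eventually_elim (use * in auto)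
    have "((\<lambda>w. cmod (w - a) * (2 * norm (R a)) * norm (R a)) \<longlongrightarrow>
        cmod (a - a) * (2 * norm (R a)) * norm (R a)) (at a within W)"
      by (intro tendsto_intros)
    then have "((\<lambda>w. R w - R a) \<longlongrightarrow> 0) (at a within W)"
      by (intro Lim_null_comparison[OF ev]) simp
    then show ?thesis using Lim_null by blast
  qed
  then show ?thesis unfolding continuous_on_def R_def by blast
qed

lemma clinear_op_integral:
  fixes F :: "real \<Rightarrow> 'a::chilbert_space \<Rightarrow>\<^sub>L 'a"
  assumes int: "F integrable_on {0..1}" and lin: "\<And>t. t \<in> {0..1} \<Longrightarrow> clinear_op (F t)"
  shows "clinear_op (integral {0..1} F)"
  unfolding clinear_op_iff
proof (intro allI)
  fix c x
  have bl: "bounded_linear (\<lambda>X :: 'a \<Rightarrow>\<^sub>L 'a. blinfun_apply (c *\<^sub>O X) x)"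
    by (rule bounded_linear_compose[OF blinfun.bounded_linear_left])
      (rule bounded_bilinear.bounded_linear_right[OF bounded_bilinear_scaleC_op])
  have "blinfun_apply (integral {0..1} F) (c *\<^sub>C x) =
      integral {0..1} ((\<lambda>X. blinfun_apply X (c *\<^sub>C x)) \<circ> F)"
    by (rule integral_linear[OF int blinfun.bounded_linear_left, symmetric])
  also have "\<dots> = integral {0..1} ((\<lambda>X. blinfun_apply (c *\<^sub>O X) x) \<circ> F)"
    by (rule integral_cong) (simp add: clinear_opD[OF lin])
  also have "\<dots> = c *\<^sub>C blinfun_apply (integral {0..1} F) x"
    using integral_linear[OF int bl] by simp
  finally show "blinfun_apply (integral {0..1} F) (c *\<^sub>C x) =
      c *\<^sub>C blinfun_apply (integral {0..1} F) x" .
qed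

text \<open>
  The operator \<open>S\<close> is \<open>1 / (2 \<pi> \<i>)\<close> times the integral of \<open>R w / (w - c)\<close> over the circle; in the
  parametrization used below this is the integral of \<open>R (g t)\<close> over the unit interval, because
  \<open>g' t = 2 \<pi> \<i> (g t - c)\<close>. Writing \<open>c - T = (w - T) - (w - c)\<close> under the integral gives
  \<open>I\<close> minus the Riesz projection.
\<close>
lemma riesz_decomposition:
  fixes T :: "'a::chilbert_space \<Rightarrow>\<^sub>L 'a"
  assumes "\<rho> > 0"
    and inv: "\<And>w. cmod (w - c) = \<rho> \<Longrightarrow> invertible_op (w *\<^sub>O id_blinfun - T)"
  obtains S where "clinear_op S"
    "(c *\<^sub>O id_blinfun - T) o\<^sub>L S = id_blinfun - riesz_projection T c \<rho>"
    "S o\<^sub>L (c *\<^sub>O id_blinfun - T) = id_blinfun - riesz_projection T c \<rho>"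
proof -
  define g where "g t = c + of_real \<rho> * exp (2 * of_real pi * \<i> * of_real t)" for t :: real
  define R where "R w = inverse_op (w *\<^sub>O id_blinfun - T)" for w
  define S where "S = integral {0..1} (\<lambda>t. R (g t))"
  have g: "cmod (g t - c) = \<rho>" for t
    using \<open>\<rho> > 0\<close> by (simp add: g_def norm_mult)
  have R: "clinear_op (R (g t))" "R (g t) o\<^sub>L (g t *\<^sub>O id_blinfun - T) = id_blinfun"
    "(g t *\<^sub>O id_blinfun - T) o\<^sub>L R (g t) = id_blinfun" for t
    using invertible_opE[OF inv[OF g[of t]]] inverse_op_eqI unfolding R_def by metis+
  have cg: "continuous_on {0..1} g" unfolding g_def by (intro continuous_intros)
  have cR: "continuous_on {0..1} (\<lambda>t. R (g t))"
    unfolding R_def using g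
    by (intro continuous_on_compose2[OF continuous_on_resolvent[of "{w. cmod (w - c) = \<rho>}"] cg] inv)
      auto
  have cP: "continuous_on {0..1} (\<lambda>t. (g t - c) *\<^sub>O R (g t))"
    by (intro bounded_bilinear.continuous_on[OF bounded_bilinear_scaleC_op] cR cg continuous_intros)
  have iR: "(\<lambda>t. R (g t)) integrable_on {0..1}"
    and iP: "(\<lambda>t. (g t - c) *\<^sub>O R (g t)) integrable_on {0..1}"
    by (intro integrable_continuous_real cR cP)+
  define P where "P = integral {0..1} (\<lambda>t. (g t - c) *\<^sub>O R (g t))"
  have P: "riesz_projection T c \<rho> = P"
  proof -
    have bl: "bounded_linear (\<lambda>X :: 'a \<Rightarrow>\<^sub>L 'a. (2 * of_real pi * \<i>) *\<^sub>O X)"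
      by (rule bounded_bilinear.bounded_linear_right[OF bounded_bilinear_scaleC_op])
    have path: "circlepath c \<rho> t = g t" for t
      by (simp add: circlepath g_def)
    have deriv: "vector_derivative (circlepath c \<rho>) (at t within {0..1}) =
        (2 * of_real pi * \<i>) * (g t - c)" if "t \<in> {0..1}" for t
      using that by (simp add: vector_derivative_circlepath01 g_def mult_ac)
    have "contour_integral_op (circlepath c \<rho>) R =
        integral {0..1} ((\<lambda>X. (2 * of_real pi * \<i>) *\<^sub>O X) \<circ> (\<lambda>t. (g t - c) *\<^sub>O R (g t)))"
      unfolding contour_integral_op_def
      by (rule integral_cong)
        (auto simp: deriv path scaleC_scaleC simp del: atLeastAtMost_iff intro!: blinfun_eqI)
    also have "\<dots> = (2 * of_real pi * \<i>) *\<^sub>O P"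
      unfolding P_def by (rule integral_linear[OF iP bl])
    finally show ?thesis
      unfolding riesz_projection_def R_def
      by (auto intro!: blinfun_eqI simp: scaleC_scaleC scaleC_one)
  qed
  have int1: "integral {0..1} (\<lambda>t. id_blinfun - (g t - c) *\<^sub>O R (g t)) = id_blinfun - P"
    unfolding P_def by (subst integral_diff[OF _ iP]) auto
  have pt1: "(c *\<^sub>O id_blinfun - T) o\<^sub>L R (g t) = id_blinfun - (g t - c) *\<^sub>O R (g t)" for t
  proof -
    have "(c *\<^sub>O id_blinfun - T) o\<^sub>L R (g t) =
        ((g t *\<^sub>O id_blinfun - T) o\<^sub>L R (g t)) - (g t - c) *\<^sub>O R (g t)"
      by (rule blinfun_eqI) (simp add: blinfun.bilinear_simps complex_vector.scale_left_diff_distrib)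
    then show ?thesis by (simp add: R)
  qed
  have pt2: "R (g t) o\<^sub>L (c *\<^sub>O id_blinfun - T) = id_blinfun - (g t - c) *\<^sub>O R (g t)" for t
  proof -
    have "R (g t) o\<^sub>L (c *\<^sub>O id_blinfun - T) =
        (R (g t) o\<^sub>L (g t *\<^sub>O id_blinfun - T)) - (g t - c) *\<^sub>O R (g t)"
      by (rule blinfun_eqI)
        (simp add: blinfun.bilinear_simps clinear_opD[OF R(1)] complex_vector.scale_left_diff_distrib)
    then show ?thesis by (simp add: R)
  qed
  show thesis
  proof
    show "clinear_op S" unfolding S_def by (intro clinear_op_integral iR R)
    have "(c *\<^sub>O id_blinfun - T) o\<^sub>L S =
        integral {0..1} ((\<lambda>X. (c *\<^sub>O id_blinfun - T) o\<^sub>L X) \<circ> (\<lambda>t. R (g t)))"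
      unfolding S_def
      by (rule integral_linear[OF iR, symmetric])
        (rule bounded_bilinear.bounded_linear_right[OF bounded_bilinear_blinfun_compose])
    then show "(c *\<^sub>O id_blinfun - T) o\<^sub>L S = id_blinfun - riesz_projection T c \<rho>"
      by (simp add: o_def pt1 int1 P)
    have "S o\<^sub>L (c *\<^sub>O id_blinfun - T) =
        integral {0..1} ((\<lambda>X. X o\<^sub>L (c *\<^sub>O id_blinfun - T)) \<circ> (\<lambda>t. R (g t)))"
      unfolding S_def
      by (rule integral_linear[OF iR, symmetric])
        (rule bounded_bilinear.bounded_linear_left[OF bounded_bilinear_blinfun_compose])
    then show "S o\<^sub>L (c *\<^sub>O id_blinfun - T) = id_blinfun - riesz_projection T c \<rho>"
      by (simp add: o_def pt2 int1 P)
  qed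
qed

text \<open>
  The Riesz projection \<open>P\<close> commutes with \<open>T\<close>, so a vector \<open>v\<close> that spans its range is an
  eigenvector, say \<open>(c - T) v = b v\<close>. If \<open>b\<close> were nonzero, then \<open>S + (1 / b) P\<close> would be an inverse
  of \<open>c - T\<close>, although \<open>c\<close> lies in the spectrum. The function \<open>\<phi>\<close> is the coordinate of \<open>P x\<close>
  along \<open>v\<close>.
\<close>
lemma simple_spectral_point:
  fixes T :: "'a::chilbert_space \<Rightarrow>\<^sub>L 'a"
  assumes T: "clinear_op T" and iso: "c isolated_in spectrum_op T"
    and rank: "\<forall>\<^sub>F \<rho> in at_right 0.
      complex_vector.dim (range (blinfun_apply (riesz_projection T c \<rho>))) = 1"
  obtains v S \<phi> where "v \<noteq> 0" "blinfun_apply T v = c *\<^sub>C v" "clinear_op S"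
    "\<And>x. c *\<^sub>C blinfun_apply S x - blinfun_apply T (blinfun_apply S x) = x - \<phi> x *\<^sub>C v"
    "\<And>x. blinfun_apply S (c *\<^sub>C x - blinfun_apply T x) = x - \<phi> x *\<^sub>C v"
proof -
  obtain U where U: "open U" "U \<inter> spectrum_op T = {c}" "c \<in> spectrum_op T"
    using iso unfolding isolated_in_def by auto
  then obtain r where r: "r > 0" "ball c r \<subseteq> U" 
    by (metis Int_iff insertI1 open_contains_ball)
  have "\<forall>\<^sub>F \<rho> in at_right 0. \<rho> > 0 \<and> \<rho> < r"
    using r(1) by (auto simp: eventually_at_right_field)
  with rank have "\<forall>\<^sub>F \<rho> in at_right 0. \<rho> > 0 \<and> \<rho> < r \<and>
      complex_vector.dim (range (blinfun_apply (riesz_projection T c \<rho>))) = 1"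
    by eventually_elim auto
  then obtain \<rho> where \<rho>: "\<rho> > 0" "\<rho> < r"
    "complex_vector.dim (range (blinfun_apply (riesz_projection T c \<rho>))) = 1"
    using eventually_happens[of _ "at_right (0::real)"] by auto
  define P where "P = riesz_projection T c \<rho>"
  define D where "D = c *\<^sub>O id_blinfun - T"
  have D: "clinear_op D" unfolding D_def by (intro clinear_op_intros T)
  have inv: "invertible_op (w *\<^sub>O id_blinfun - T)" if "cmod (w - c) = \<rho>" for w
  proof -
    have "w \<in> U" "w \<noteq> c" using that \<rho> r(2) by (auto simp: dist_norm norm_minus_commute)
    with U(2) have "w \<notin> spectrum_op T" by blast
    then show ?thesis by (simp add: spectrum_op_def)
  qed
  obtain S where S: "clinear_op S" "D o\<^sub>L S = id_blinfun - P" "S o\<^sub>L D = id_blinfun - P"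
    using riesz_decomposition[OF \<rho>(1) inv] unfolding D_def P_def by metis
  have S': "blinfun_apply D (blinfun_apply S x) = x - blinfun_apply P x"
    "blinfun_apply S (blinfun_apply D x) = x - blinfun_apply P x" for x
  proof -
    have "blinfun_apply (D o\<^sub>L S) x = x - blinfun_apply P x"
      "blinfun_apply (S o\<^sub>L D) x = x - blinfun_apply P x"
      by (simp_all add: S blinfun.diff_left)
    then show "blinfun_apply D (blinfun_apply S x) = x - blinfun_apply P x"
      "blinfun_apply S (blinfun_apply D x) = x - blinfun_apply P x" by simp_all
  qed
  have DP: "blinfun_apply D (blinfun_apply P x) = blinfun_apply P (blinfun_apply D x)" for x
  proof -
    have "blinfun_apply D (x - blinfun_apply P x) = blinfun_apply D x - blinfun_apply P (blinfun_apply D x)"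
      by (metis S')
    then show ?thesis by (simp add: blinfun.diff_right)
  qed
  have P: "clinear_op P"
  proof -
    have "P = id_blinfun - (D o\<^sub>L S)" by (simp add: S)
    then show ?thesis using D S(1) by (metis clinear_op_id clinear_op_compose clinear_op_diff)
  qed
  obtain B where B: "B \<subseteq> range (blinfun_apply P)" "complex_vector.independent B"
    "range (blinfun_apply P) \<subseteq> complex_vector.span B" "card B = 1"
    using complex_vector.basis_exists[of "range (blinfun_apply P)"] \<rho>(3) unfolding P_def by metis
  obtain v where Bv: "B = {v}" using B(4) card_1_singletonE by blast
  have v0: "v \<noteq> 0" using B(2) unfolding Bv by (metis complex_vector.dependent_single)
  have "\<exists>a. blinfun_apply P x = a *\<^sub>C v" for x
    using B(3) unfolding Bv complex_vector.span_singleton by auto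
  then obtain \<phi> where Pv: "\<And>x. blinfun_apply P x = \<phi> x *\<^sub>C v" by metis
  obtain x0 where x0: "v = blinfun_apply P x0" using B(1) Bv by auto
  obtain b where b: "blinfun_apply D v = b *\<^sub>C v" using Pv DP x0 by metis
  have "b = 0"
  proof (rule ccontr)
    assume b0: "b \<noteq> 0"
    have DPb: "blinfun_apply D (blinfun_apply P x) = b *\<^sub>C blinfun_apply P x" for x
      using Pv[of x] by (auto simp: clinear_opD[OF D] b scaleC_scaleC mult.commute)
    have "invertible_op D"
    proof (rule invertible_opI[of "S + (1 / b) *\<^sub>O P"])
      show "clinear_op (S + (1 / b) *\<^sub>O P)" by (intro clinear_op_intros S P)
      show "blinfun_apply D (blinfun_apply (S + (1 / b) *\<^sub>O P) x) = x"
        "blinfun_apply (S + (1 / b) *\<^sub>O P) (blinfun_apply D x) = x" for x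
        using b0
        by (simp_all add: blinfun.bilinear_simps S' clinear_opD[OF D] DPb scaleC_scaleC scaleC_one
            flip: DP)
    qed
    with U(3) show False by (simp add: spectrum_op_def D_def)
  qed
  show thesis
  proof (rule that[of v S \<phi>])
    show "blinfun_apply T v = c *\<^sub>C v" using b \<open>b = 0\<close> by (simp add: D_def blinfun.diff_left)
    show "c *\<^sub>C blinfun_apply S x - blinfun_apply T (blinfun_apply S x) = x - \<phi> x *\<^sub>C v" for x
      using S'(1)[of x] Pv[of x] by (simp add: D_def blinfun.diff_left)
    show "blinfun_apply S (c *\<^sub>C x - blinfun_apply T x) = x - \<phi> x *\<^sub>C v" for x
      using S'(2)[of x] Pv[of x] by (simp add: D_def blinfun.diff_left)
  qed (use v0 S in auto)
qed

text \<open>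
  The adjoint \<open>Q\<close> maps the eigenspace of \<open>T\<close> into itself, so \<open>u = Q v - cnj c v\<close> lies in it, and
  \<open>u\<close> is orthogonal to that eigenspace by the definition of the adjoint.
\<close>
lemma adjoint_eigenvector:
  fixes T Q :: "'a::chilbert_space \<Rightarrow>\<^sub>L 'a"
  assumes adj: "is_adjoint Q T" and comm: "T o\<^sub>L Q = Q o\<^sub>L T"
    and v: "blinfun_apply T v = c *\<^sub>C v"
  shows "blinfun_apply Q v = cnj c *\<^sub>C v"
proof -
  have adj': "cinner x (blinfun_apply Q y) = cinner (blinfun_apply T x) y" for x y
    using adj by (simp add: is_adjoint_def)
  have "blinfun_apply T (blinfun_apply Q v) = blinfun_apply Q (c *\<^sub>C v)"
    using comm v by (metis blinfun_apply_blinfun_compose)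
  also have "\<dots> = c *\<^sub>C blinfun_apply Q v" by (rule clinear_opD[OF clinear_op_adjoint[OF adj]])
  finally have TQ: "blinfun_apply T (blinfun_apply Q v) = c *\<^sub>C blinfun_apply Q v" .
  define u where "u = blinfun_apply Q v + (- cnj c) *\<^sub>C v"
  have "cinner x u = cinner (blinfun_apply T x) v - c * cinner x v" for x
    by (simp add: u_def cinner_add_right cinner_scaleC_right adj' del: complex_vector.scale_minus_left)
  moreover have "cinner (blinfun_apply T (blinfun_apply Q v)) v = c * cinner (blinfun_apply Q v) v"
    "cinner (blinfun_apply T v) v = c * cinner v v"
    by (simp_all add: TQ v cinner_scaleC_left)
  ultimately have "cinner (blinfun_apply Q v) u = 0" "cinner v u = 0"
    by simp_all
  then have "cinner u u = 0"
    unfolding u_def[symmetric] by (subst (1) u_def) (simp add: cinner_add_left cinner_scaleC_left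
      del: complex_vector.scale_minus_left)
  then have "u = 0" by (simp add: cinner_self)
  then show ?thesis by (simp add: u_def)
qed

text \<open>
  Normality makes the eigenvector an eigenvector of the adjoint as well, so the range of \<open>c - T\<close> is
  orthogonal to \<open>e\<close>. This forces the rank one projection to be the orthogonal one.
\<close>
lemma normal_simple_spectral_point:
  fixes T :: "'a::chilbert_space \<Rightarrow>\<^sub>L 'a"
  assumes T: "clinear_op T" and "normal_op T" and iso: "c isolated_in spectrum_op T"
    and rank: "\<forall>\<^sub>F \<rho> in at_right 0.
      complex_vector.dim (range (blinfun_apply (riesz_projection T c \<rho>))) = 1"
  obtains e S where "norm e = 1" "blinfun_apply T e = c *\<^sub>C e" "clinear_op S"
    "\<And>x. cinner (blinfun_apply T x) e = c * cinner x e"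
    "\<And>x. c *\<^sub>C blinfun_apply S x - blinfun_apply T (blinfun_apply S x) = x - cinner x e *\<^sub>C e"
    "\<And>x. blinfun_apply S (c *\<^sub>C x - blinfun_apply T x) = x - cinner x e *\<^sub>C e"
proof -
  obtain v S \<phi> where v: "v \<noteq> 0" "blinfun_apply T v = c *\<^sub>C v" and S: "clinear_op S"
    "\<And>x. c *\<^sub>C blinfun_apply S x - blinfun_apply T (blinfun_apply S x) = x - \<phi> x *\<^sub>C v"
    "\<And>x. blinfun_apply S (c *\<^sub>C x - blinfun_apply T x) = x - \<phi> x *\<^sub>C v"
    using simple_spectral_point[OF T iso rank] by metis
  define e where "e = complex_of_real (1 / norm v) *\<^sub>C v"
  have ve: "v = complex_of_real (norm v) *\<^sub>C e"
    using v(1) by (simp add: e_def scaleC_scaleC scaleC_one)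
  have e: "norm e = 1" "blinfun_apply T e = c *\<^sub>C e"
    using v by (auto simp: e_def norm_scaleC clinear_opD[OF T] scaleC_scaleC mult.commute norm_divide)
  have ee: "cinner e e = 1" using e by (simp add: cinner_self)
  obtain Q where Q: "is_adjoint Q T" "T o\<^sub>L Q = Q o\<^sub>L T"
    using \<open>normal_op T\<close> unfolding normal_op_def by blast
  have Te: "cinner (blinfun_apply T x) e = c * cinner x e" for x
    using Q(1) adjoint_eigenvector[OF Q e(2)] by (simp add: is_adjoint_def cinner_scaleC_right)
  have \<phi>: "\<phi> x *\<^sub>C v = cinner x e *\<^sub>C e" for x
  proof -
    define b where "b = \<phi> x * complex_of_real (norm v)"
    have b: "\<phi> x *\<^sub>C v = b *\<^sub>C e" using ve by (metis b_def scaleC_scaleC)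
    have "cinner (x - b *\<^sub>C e) e =
        cinner (c *\<^sub>C blinfun_apply S x - blinfun_apply T (blinfun_apply S x)) e"
      using S(2)[of x] b by simp
    also have "\<dots> = 0" by (simp add: cinner_diff_left cinner_scaleC_left Te)
    finally show ?thesis by (simp add: b cinner_diff_left cinner_scaleC_left ee)
  qed
  show thesis by (rule that[of e S]) (use e S \<phi> Te in auto)
qed

section \<open>Perturbation of a simple eigenvalue\<close>

text \<open>
  A Schur complement argument. Applying \<open>S\<close> to \<open>(I - T) v = C v\<close> gives \<open>(I - S C) v = \<langle>v, e\<rangle> e\<close>, so a
  kernel vector of \<open>T - I + C\<close> must be a multiple of \<open>N e\<close> with \<open>N = (I - S C)\<^sup>-\<^sup>1\<close>, and the
  remaining equation along \<open>e\<close> is \<open>h = \<langle>C N e, e\<rangle> = 0\<close>. Conversely \<open>h \<noteq> 0\<close> makes \<open>T - I + C\<close>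
  invertible. Since \<open>N e = e + S C N e\<close>, the number \<open>h\<close> differs from \<open>\<langle>C e, e\<rangle>\<close> by a term of
  second order in \<open>C\<close>.
\<close>
lemma perturbed_simple_eigenvalue:
  fixes T C S :: "'a::chilbert_space \<Rightarrow>\<^sub>L 'a"
  assumes T: "clinear_op T" and C: "clinear_op C" and S: "clinear_op S"
    and e: "norm e = 1" "blinfun_apply T e = e" "\<And>x. cinner (blinfun_apply T x) e = cinner x e"
    and S1: "\<And>x. blinfun_apply S x - blinfun_apply T (blinfun_apply S x) = x - cinner x e *\<^sub>C e"
    and S2: "\<And>x. blinfun_apply S (x - blinfun_apply T x) = x - cinner x e *\<^sub>C e"
    and small: "norm S * norm C \<le> 1 / 2"
    and sing: "\<not> invertible_op (T - id_blinfun + C)"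
  shows "cmod (cinner (blinfun_apply C e) e) \<le> 2 * norm S * (norm C)\<^sup>2"
proof -
  have SC: "norm (S o\<^sub>L C) \<le> 1 / 2" using norm_blinfun_compose[of S C] small by linarith
  have "invertible_op (id_blinfun - (S o\<^sub>L C))"
    by (rule invertible_op_id_minus) (use SC clinear_op_compose S C in auto)
  then obtain N where N: "clinear_op N"
    "\<And>x. blinfun_apply (id_blinfun - (S o\<^sub>L C)) (blinfun_apply N x) = x"
    "\<And>x. blinfun_apply N (blinfun_apply (id_blinfun - (S o\<^sub>L C)) x) = x"
    using invertible_opE by metis
  have N1: "blinfun_apply N x = blinfun_apply S (blinfun_apply C (blinfun_apply N x)) + x" for x
    using N(2)[of x] by (simp add: blinfun.diff_left algebra_simps)
  have N2: "blinfun_apply N (x - blinfun_apply S (blinfun_apply C x)) = x" for x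
    using N(3)[of x] by (simp add: blinfun.diff_left)
  define h where "h = cinner (blinfun_apply C (blinfun_apply N e)) e"
  have "h = 0"
  proof (rule ccontr)
    assume h: "h \<noteq> 0"
    define k where "k = norm C * norm N * norm S"
    have "invertible_op (T - id_blinfun + C)"
    proof (rule invertible_opI_bounded_solution[where M = "norm N * (norm S + (1 + k) / cmod h)"])
      show "clinear_op (T - id_blinfun + C)" by (intro clinear_op_intros T C)
    next
      fix v assume "blinfun_apply (T - id_blinfun + C) v = 0"
      then have Cv: "blinfun_apply C v = v - blinfun_apply T v"
        by (simp add: blinfun.bilinear_simps algebra_simps add_eq_0_iff2)
      then have "v - blinfun_apply S (blinfun_apply C v) = cinner v e *\<^sub>C e" by (simp add: S2)
      then have v: "v = cinner v e *\<^sub>C blinfun_apply N e" using N2[of v] clinear_opD[OF N(1)] by metis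
      have "0 = cinner (blinfun_apply C v) e" by (simp add: Cv cinner_diff_left e)
      also have "\<dots> = cinner v e * h"
        by (subst v) (simp add: clinear_opD[OF C] cinner_scaleC_left h_def)
      finally show "v = 0" using v h by simp
    next
      fix f
      define s where "s = cinner (blinfun_apply C (blinfun_apply N (blinfun_apply S f))) e"
      \<comment> \<open>The choice of \<open>a\<close> makes \<open>C v - f\<close> orthogonal to \<open>e\<close>, so that \<open>I - T\<close> can be solved for it.\<close>
      define a where "a = (cinner f e + s) / h"
      define v where "v = a *\<^sub>C blinfun_apply N e - blinfun_apply N (blinfun_apply S f)"
      have vN: "v = blinfun_apply N (a *\<^sub>C e - blinfun_apply S f)"
        by (simp add: v_def clinear_opD[OF N(1)] blinfun.diff_right)
      have v: "v = blinfun_apply S (blinfun_apply C v - f) + a *\<^sub>C e"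
        using N1[of "a *\<^sub>C e - blinfun_apply S f", folded vN]
        by (simp add: blinfun.diff_right add_diff_eq diff_add_eq)
      have "cinner (blinfun_apply C v) e = a * h - s"
        by (simp add: v_def blinfun.diff_right clinear_opD[OF C] cinner_diff_left
            cinner_scaleC_left h_def s_def)
      also have "\<dots> = cinner f e" using h by (simp add: a_def)
      finally have Cvf: "cinner (blinfun_apply C v - f) e = 0" by (simp add: cinner_diff_left)
      have Tv: "blinfun_apply T v =
          blinfun_apply T (blinfun_apply S (blinfun_apply C v - f)) + a *\<^sub>C e"
        using arg_cong[OF v, of "blinfun_apply T"]
        by (simp add: blinfun.add_right clinear_opD[OF T] e)
      have "v - blinfun_apply T v = blinfun_apply C v - f"
        using S1[of "blinfun_apply C v - f"] Tv Cvf
        by (subst (1) v) (simp add: algebra_simps)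
      then have eq: "blinfun_apply (T - id_blinfun + C) v = f"
        by (simp add: blinfun.bilinear_simps algebra_simps)
      have Sf: "norm (blinfun_apply S f) \<le> norm S * norm f" by (rule norm_blinfun)
      have NSf: "norm (blinfun_apply N (blinfun_apply S f)) \<le> norm N * (norm S * norm f)"
        by (rule order_trans[OF norm_blinfun mult_left_mono[OF Sf]]) simp
      have "cmod s \<le> norm (blinfun_apply C (blinfun_apply N (blinfun_apply S f)))"
        using norm_cinner_le[of "blinfun_apply C (blinfun_apply N (blinfun_apply S f))" e] e
        by (simp add: s_def)
      also have "\<dots> \<le> norm C * (norm N * (norm S * norm f))"
        by (rule order_trans[OF norm_blinfun mult_left_mono[OF NSf]]) simp
      finally have "cmod s \<le> k * norm f" by (simp add: k_def mult_ac)
      moreover have "cmod (cinner f e) \<le> norm f" using norm_cinner_le[of f e] e by simp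
      ultimately have "cmod (cinner f e + s) \<le> (1 + k) * norm f"
        using norm_triangle_ineq[of "cinner f e" s] by (simp add: algebra_simps)
      then have a: "cmod a \<le> (1 + k) / cmod h * norm f"
        using h by (simp add: a_def norm_divide divide_right_mono)
      have "norm (blinfun_apply N e) \<le> norm N" using norm_blinfun[of N e] e by simp
      with a have "cmod a * norm (blinfun_apply N e) \<le> ((1 + k) / cmod h * norm f) * norm N"
        by (intro mult_mono) (auto simp: k_def)
      moreover have "norm v \<le> cmod a * norm (blinfun_apply N e)
          + norm (blinfun_apply N (blinfun_apply S f))"
        unfolding v_def by (rule order_trans[OF norm_triangle_ineq4]) (simp add: norm_scaleC)
      ultimately have "norm v \<le> norm N * (norm S + (1 + k) / cmod h) * norm f"
        using NSf by (simp add: algebra_simps)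
      with eq show "\<exists>v. blinfun_apply (T - id_blinfun + C) v = f \<and>
          norm v \<le> norm N * (norm S + (1 + k) / cmod h) * norm f" by blast
    qed
    with sing show False ..
  qed
  define w where "w = blinfun_apply S (blinfun_apply C (blinfun_apply N e))"
  have Ne: "blinfun_apply N e = w + e" using N1[of e] by (simp add: w_def)
  have w: "norm w \<le> norm S * norm C * norm (blinfun_apply N e)"
    unfolding w_def mult.assoc by (rule order_trans[OF norm_blinfun mult_left_mono[OF norm_blinfun]]) simp
  also have "\<dots> \<le> 1 / 2 * norm (blinfun_apply N e)" by (intro mult_right_mono small) simp
  finally have Ne2: "norm (blinfun_apply N e) \<le> 2"
    using norm_triangle_ineq[of w e] e by (simp add: Ne)
  have "0 = cinner (blinfun_apply C e) e + cinner (blinfun_apply C w) e"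
    using \<open>h = 0\<close> unfolding h_def Ne by (simp add: blinfun.add_right cinner_add_left add.commute)
  then have "cmod (cinner (blinfun_apply C e) e) = cmod (cinner (blinfun_apply C w) e)"
    by (metis add_eq_0_iff norm_minus_cancel)
  also have "\<dots> \<le> norm (blinfun_apply C w)" using norm_cinner_le[of "blinfun_apply C w" e] e by simp
  also have "\<dots> \<le> norm C * norm w" by (rule norm_blinfun)
  also have "\<dots> \<le> norm C * (norm S * norm C * 2)"
    by (intro mult_left_mono order_trans[OF w] Ne2) auto
  finally show ?thesis by (simp add: power2_eq_square mult_ac)
qed

text \<open>
  With \<open>x = 1 + \<xi> \<delta>\<close> and \<open>z = \<delta> - y\<close>, the equation says that \<open>(x, y, z)\<close> lies on the surface
  \<open>x\<^sup>n + y\<^sup>n + (-1)\<^bsup>n-1\<^esup> z\<^sup>n = 1\<close>, since \<open>(-1)\<^bsup>n-1\<^esup> (\<delta> - y)\<^sup>n = - (y - \<delta>)\<^sup>n\<close>. The surface contains the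
  line \<open>(1, y, - y)\<close>; fixing \<open>y\<close> and varying \<open>\<delta>\<close> gives a curve that leaves this line at \<open>\<delta> = 0\<close>,
  and implicit differentiation gives its slope there.
\<close>
lemma root_branch_expansion:
  fixes y :: complex
  assumes n: "n \<ge> 1"
  obtains \<xi> where "\<forall>\<^sub>F \<delta> in at 0. (1 + \<xi> \<delta>) ^ n = 1 - y ^ n + (y - \<delta>) ^ n"
    "((\<lambda>\<delta>. \<xi> \<delta> / \<delta>) \<longlongrightarrow> - (y ^ (n - 1))) (at 0)" "(\<xi> \<longlongrightarrow> 0) (at 0)"
proof -
  define f where "f \<delta> = 1 - y ^ n + (y - \<delta>) ^ n" for \<delta> :: complex
  define \<xi> where "\<xi> \<delta> = exp (Ln (f \<delta>) / of_nat n) - 1" for \<delta>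
  have f0: "f 0 = 1" by (simp add: f_def)
  have df: "(f has_field_derivative - (of_nat n * y ^ (n - 1))) (at 0)"
    unfolding f_def by (rule derivative_eq_intros refl | simp)+
  have d: "(\<xi> has_field_derivative - (y ^ (n - 1))) (at 0)"
    unfolding \<xi>_def by (rule derivative_eq_intros df refl | use n f0 in \<open>simp\<close>)+
  have \<xi>0: "\<xi> 0 = 0" by (simp add: \<xi>_def f0)
  show thesis
  proof
    have "(f \<longlongrightarrow> f 0) (at 0)" using DERIV_isCont[OF df] by (simp add: isCont_def)
    then have "\<forall>\<^sub>F \<delta> in at 0. f \<delta> \<noteq> 0" using f0 by (intro tendsto_imp_eventually_ne) auto
    then show "\<forall>\<^sub>F \<delta> in at 0. (1 + \<xi> \<delta>) ^ n = 1 - y ^ n + (y - \<delta>) ^ n"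
    proof eventually_elim
      case (elim \<delta>)
      have "(1 + \<xi> \<delta>) ^ n = exp (of_nat n * (Ln (f \<delta>) / of_nat n))"
        by (simp add: \<xi>_def flip: exp_of_nat_mult)
      then show ?case using elim n by (simp add: f_def)
    qed
    show "((\<lambda>\<delta>. \<xi> \<delta> / \<delta>) \<longlongrightarrow> - (y ^ (n - 1))) (at 0)"
      using d unfolding has_field_derivative_iff by (simp add: \<xi>0)
    show "(\<xi> \<longlongrightarrow> 0) (at 0)" using DERIV_isCont[OF d] by (simp add: isCont_def \<xi>0)
  qed
qed

text \<open>
  At \<open>(1, y, - y)\<close> the pencil factors: \<open>T + y B - y T B - I = (T - I) (I - y B)\<close>. At the nearby
  surface point \<open>(1 + \<xi> \<delta>, y, \<delta> - y)\<close> it becomes \<open>(T - I + C) (I - y B)\<close> with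
  \<open>C = T (\<xi> \<delta> + \<delta> B) (I - y B)\<^sup>-\<^sup>1\<close>, which is of first order in \<open>\<delta>\<close>. The perturbation estimate gives
  \<open>\<xi> \<delta> \<langle>v, e\<rangle> + \<delta> \<langle>B v, e\<rangle> = O (\<delta>\<^sup>2)\<close> with \<open>v = (I - y B)\<^sup>-\<^sup>1 e\<close>; dividing by \<open>\<delta>\<close> and using
  \<open>\<xi> \<delta> / \<delta> \<longlongrightarrow> - y\<^bsup>n-1\<^esup>\<close> yields the relation.
\<close>
lemma resolvent_relation_at_simple_eigenvalue:
  fixes T B S :: "'a::chilbert_space \<Rightarrow>\<^sub>L 'a"
  assumes T: "clinear_op T" and B: "clinear_op B" "norm B \<le> 1" and S: "clinear_op S"
    and e: "norm e = 1" "blinfun_apply T e = e" "\<And>x. cinner (blinfun_apply T x) e = cinner x e"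
    and S1: "\<And>x. blinfun_apply S x - blinfun_apply T (blinfun_apply S x) = x - cinner x e *\<^sub>C e"
    and S2: "\<And>x. blinfun_apply S (x - blinfun_apply T x) = x - cinner x e *\<^sub>C e"
    and n: "n \<ge> 1" and "\<epsilon> > 0"
    and sing: "\<And>x y z. cmod (x - 1) < \<epsilon> \<Longrightarrow> cmod y < \<epsilon> \<Longrightarrow> cmod z < \<epsilon> \<Longrightarrow>
      x ^ n + y ^ n + (- 1) ^ (n - 1) * z ^ n = 1 \<Longrightarrow>
      \<not> invertible_op (x *\<^sub>O T + y *\<^sub>O B + z *\<^sub>O (T o\<^sub>L B) - id_blinfun)"
    and y: "cmod y < \<epsilon>" "cmod y < 1"
    and v: "v - y *\<^sub>C blinfun_apply B v = e"
  shows "cinner (blinfun_apply B v) e = y ^ (n - 1) * cinner v e"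
proof -
  obtain \<xi> where \<xi>: "\<forall>\<^sub>F \<delta> in at 0. (1 + \<xi> \<delta>) ^ n = 1 - y ^ n + (y - \<delta>) ^ n"
    "((\<lambda>\<delta>. \<xi> \<delta> / \<delta>) \<longlongrightarrow> - (y ^ (n - 1))) (at 0)" "(\<xi> \<longlongrightarrow> 0) (at 0)"
    by (rule root_branch_expansion[OF n, of y])
  have inv: "invertible_op (id_blinfun - y *\<^sub>O B)"
    by (rule invertible_op_id_minus_scaleC[OF B y(2)])
  then obtain R where R: "clinear_op R"
    "\<And>x. blinfun_apply R (blinfun_apply (id_blinfun - y *\<^sub>O B) x) = x"
    using invertible_opE by metis
  have Rv: "blinfun_apply R e = v"
    using R(2)[of v] v by (simp add: blinfun.diff_left)
  define C where "C \<delta> = T o\<^sub>L ((\<xi> \<delta> *\<^sub>O id_blinfun + \<delta> *\<^sub>O B) o\<^sub>L R)" for \<delta>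
  define q where "q \<delta> = cmod (\<xi> \<delta>) + cmod \<delta>" for \<delta>
  define k where "k = norm T * norm R"
  have C: "clinear_op (C \<delta>)" for \<delta>
    unfolding C_def by (intro clinear_op_intros T B R)
  have Cq: "norm (C \<delta>) \<le> k * q \<delta>" for \<delta>
  proof -
    have "norm (\<xi> \<delta> *\<^sub>O (id_blinfun :: 'a \<Rightarrow>\<^sub>L 'a)) \<le> cmod (\<xi> \<delta>) * 1"
      by (rule order_trans[OF norm_scaleC_op mult_left_mono[OF norm_blinfun_id_le]]) simp
    moreover have "norm (\<delta> *\<^sub>O B) \<le> cmod \<delta> * 1"
      by (rule order_trans[OF norm_scaleC_op mult_left_mono[OF B(2)]]) simp
    ultimately have "norm (\<xi> \<delta> *\<^sub>O id_blinfun + \<delta> *\<^sub>O B) \<le> q \<delta>"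
      using norm_triangle_ineq[of "\<xi> \<delta> *\<^sub>O id_blinfun" "\<delta> *\<^sub>O B"] by (simp add: q_def)
    then have "norm T * (norm (\<xi> \<delta> *\<^sub>O id_blinfun + \<delta> *\<^sub>O B) * norm R) \<le> norm T * (q \<delta> * norm R)"
      by (intro mult_left_mono mult_right_mono) auto
    moreover have "norm (C \<delta>) \<le> norm T * (norm (\<xi> \<delta> *\<^sub>O id_blinfun + \<delta> *\<^sub>O B) * norm R)"
      unfolding C_def
      by (rule order_trans[OF norm_blinfun_compose mult_left_mono[OF norm_blinfun_compose]]) simp
    ultimately show ?thesis by (simp add: k_def mult_ac)
  qed
  have Ce: "cinner (blinfun_apply (C \<delta>) e) e = \<xi> \<delta> * cinner v e + \<delta> * cinner (blinfun_apply B v) e"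
    for \<delta>
    by (simp add: C_def Rv e blinfun.add_left cinner_add_left cinner_scaleC_left)
  have factor: "(T - id_blinfun + C \<delta>) o\<^sub>L (id_blinfun - y *\<^sub>O B) =
      (1 + \<xi> \<delta>) *\<^sub>O T + y *\<^sub>O B + (\<delta> - y) *\<^sub>O (T o\<^sub>L B) - id_blinfun" for \<delta>
  proof (rule blinfun_eqI)
    fix x
    define w where "w = blinfun_apply (id_blinfun - y *\<^sub>O B) x"
    have w: "w = x - y *\<^sub>C blinfun_apply B x" by (simp add: w_def blinfun.diff_left)
    have "blinfun_apply (C \<delta>) w = \<xi> \<delta> *\<^sub>C blinfun_apply T x + \<delta> *\<^sub>C blinfun_apply T (blinfun_apply B x)"
      using R(2)[of x, folded w_def]
      by (simp add: C_def blinfun.add_left blinfun.add_right clinear_opD[OF T])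
    then have "blinfun_apply (T - id_blinfun + C \<delta>) w =
        blinfun_apply ((1 + \<xi> \<delta>) *\<^sub>O T + y *\<^sub>O B + (\<delta> - y) *\<^sub>O (T o\<^sub>L B) - id_blinfun) x"
      by (simp add: w blinfun.bilinear_simps clinear_opD[OF T] scaleC_add_left scaleC_one
          complex_vector.scale_left_diff_distrib)
    then show "blinfun_apply ((T - id_blinfun + C \<delta>) o\<^sub>L (id_blinfun - y *\<^sub>O B)) x =
        blinfun_apply ((1 + \<xi> \<delta>) *\<^sub>O T + y *\<^sub>O B + (\<delta> - y) *\<^sub>O (T o\<^sub>L B) - id_blinfun) x"
      by (simp add: w_def)
  qed
  have q0: "(q \<longlongrightarrow> 0) (at 0)"
    unfolding q_def using tendsto_add[OF tendsto_norm[OF \<xi>(3)] tendsto_norm[OF tendsto_ident_at]]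
    by simp
  have ev_small: "\<forall>\<^sub>F \<delta> in at 0. norm S * (k * q \<delta>) < 1 / 2"
  proof -
    have "((\<lambda>\<delta>. norm S * (k * q \<delta>)) \<longlongrightarrow> norm S * (k * 0)) (at 0)" by (intro tendsto_intros q0)
    then show ?thesis by (rule order_tendstoD) simp
  qed
  have ev_x: "\<forall>\<^sub>F \<delta> in at 0. cmod (\<xi> \<delta>) < \<epsilon>"
    using order_tendstoD(2)[OF tendsto_norm[OF \<xi>(3)], of \<epsilon>] \<open>\<epsilon> > 0\<close> by simp
  have ev_z: "\<forall>\<^sub>F \<delta> in at 0. cmod (\<delta> - y) < \<epsilon>"
  proof -
    have "((\<lambda>\<delta>. cmod (\<delta> - y)) \<longlongrightarrow> cmod (0 - y)) (at 0)" by (intro tendsto_intros)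
    then show ?thesis by (rule order_tendstoD) (use y in simp)
  qed
  have bound: "\<forall>\<^sub>F \<delta> in at 0. cmod (\<xi> \<delta> / \<delta> * cinner v e + cinner (blinfun_apply B v) e) \<le>
      2 * norm S * k\<^sup>2 * (q \<delta> * (cmod (\<xi> \<delta> / \<delta>) + 1))"
    using ev_small ev_x ev_z \<xi>(1) eventually_neq_at_within[of 0 0 UNIV] 
  proof eventually_elim
    case (elim \<delta>)
    have sgn: "(- 1) ^ (n - 1) * (\<delta> - y) ^ n = - ((y - \<delta>) ^ n)"
    proof -
      have "(\<delta> - y) ^ n = (- 1) ^ n * (y - \<delta>) ^ n" by (simp flip: power_mult_distrib)
      moreover have "(- 1 :: complex) ^ (n - 1) * (- 1) ^ n = - 1"
        using n power_add[of "- 1 :: complex" "n - 1" "n - 1"] by (cases n) simp_all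
      ultimately show ?thesis by (metis mult.assoc mult_minus1)
    qed
    have "\<not> invertible_op ((1 + \<xi> \<delta>) *\<^sub>O T + y *\<^sub>O B + (\<delta> - y) *\<^sub>O (T o\<^sub>L B) - id_blinfun)"
      by (rule sing) (use elim y sgn in auto)
    then have "\<not> invertible_op (T - id_blinfun + C \<delta>)"
      using invertible_op_compose[OF _ inv] factor by metis
    then have "cmod (cinner (blinfun_apply (C \<delta>) e) e) \<le> 2 * norm S * (norm (C \<delta>))\<^sup>2"
    proof (rule perturbed_simple_eigenvalue[OF T C S e S1 S2, rotated])
      show "norm S * norm (C \<delta>) \<le> 1 / 2"
        using mult_left_mono[OF Cq[of \<delta>], of "norm S"] elim by simp
    qed
    also have "\<dots> \<le> 2 * norm S * (k * q \<delta>)\<^sup>2"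
      by (intro mult_left_mono power_mono Cq) auto
    finally have bound: "cmod (\<xi> \<delta> * cinner v e + \<delta> * cinner (blinfun_apply B v) e) / cmod \<delta>
        \<le> 2 * norm S * (k * q \<delta>)\<^sup>2 / cmod \<delta>"
      unfolding Ce by (rule divide_right_mono) simp
    have quot: "(\<xi> \<delta> * cinner v e + \<delta> * cinner (blinfun_apply B v) e) / \<delta> =
        \<xi> \<delta> / \<delta> * cinner v e + cinner (blinfun_apply B v) e"
      using elim(5) by (simp add: add_divide_distrib)
    have bound_eq: "2 * norm S * (k * q \<delta>)\<^sup>2 / cmod \<delta> = 2 * norm S * k\<^sup>2 * (q \<delta> * (cmod (\<xi> \<delta> / \<delta>) + 1))"
    proof -
      have "2 * norm S * (k * q \<delta>)\<^sup>2 / cmod \<delta> = 2 * norm S * k\<^sup>2 * (q \<delta> * (q \<delta> / cmod \<delta>))"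
        by (simp add: power2_eq_square)
      also have "q \<delta> / cmod \<delta> = cmod (\<xi> \<delta> / \<delta>) + 1"
        using elim(5) by (simp add: q_def add_divide_distrib norm_divide)
      finally show ?thesis .
    qed
    show ?case using bound unfolding norm_divide[symmetric] quot bound_eq .
  qed
  have "((\<lambda>\<delta>. 2 * norm S * k\<^sup>2 * (q \<delta> * (cmod (\<xi> \<delta> / \<delta>) + 1))) \<longlongrightarrow>
      2 * norm S * k\<^sup>2 * (0 * (cmod (- (y ^ (n - 1))) + 1))) (at 0)"
    by (intro tendsto_intros q0 \<xi>)
  then have "((\<lambda>\<delta>. 2 * norm S * k\<^sup>2 * (q \<delta> * (cmod (\<xi> \<delta> / \<delta>) + 1))) \<longlongrightarrow> 0) (at 0)"
    by (simp only: mult_zero_left mult_zero_right)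
  with bound have "((\<lambda>\<delta>. \<xi> \<delta> / \<delta> * cinner v e + cinner (blinfun_apply B v) e) \<longlongrightarrow> 0) (at 0)"
    by (rule Lim_null_comparison)
  moreover have "((\<lambda>\<delta>. \<xi> \<delta> / \<delta> * cinner v e + cinner (blinfun_apply B v) e) \<longlongrightarrow>
      - (y ^ (n - 1)) * cinner v e + cinner (blinfun_apply B v) e) (at 0)"
    by (intro tendsto_intros \<xi>)
  ultimately have "- (y ^ (n - 1)) * cinner v e + cinner (blinfun_apply B v) e = 0"
    by (rule tendsto_unique[OF at_neq_bot, rotated])
  then show ?thesis by (simp add: algebra_simps)
qed

section \<open>Moments of a contraction at an eigenvector\<close>

text \<open>
  Once the coefficients below \<open>m\<close> vanish, divide by \<open>y\<^sup>m\<close> and let \<open>y\<close> tend to \<open>0\<close>.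
\<close>
lemma vanishing_power_series:
  fixes c :: "nat \<Rightarrow> complex"
  assumes "r > 0" and sums: "\<And>y. y \<noteq> 0 \<Longrightarrow> cmod y < r \<Longrightarrow> (\<lambda>k. c k * y ^ k) sums 0"
  shows "c m = 0"
proof (induction m rule: less_induct)
  case (less m)
  have "(\<lambda>k. c (k + m) * y ^ k) sums 0" if y: "y \<noteq> 0" "cmod y < r" for y
  proof -
    have "(\<lambda>k. c (k + m) * y ^ (k + m)) sums 0"
      using sums_split_initial_segment[OF sums[OF y], of m] less by simp
    then have "(\<lambda>k. c (k + m) * y ^ (k + m) / y ^ m) sums (0 / y ^ m)" by (rule sums_divide)
    then show ?thesis using y by (simp add: power_add)
  qed
  then have "((\<lambda>_. 0) \<longlongrightarrow> c (0 + m)) (at (0::complex))"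
    by (intro powser_limit_0_strong[OF \<open>r > 0\<close>])
  then show ?case by (simp add: tendsto_const_iff)
qed

lemma norm_funpow_le:
  fixes B :: "'a::real_normed_vector \<Rightarrow>\<^sub>L 'a"
  assumes "norm B \<le> 1"
  shows "norm ((blinfun_apply B ^^ k) x) \<le> norm x"
proof (induction k)
  case (Suc k)
  have "norm (blinfun_apply B ((blinfun_apply B ^^ k) x)) \<le> norm B * norm ((blinfun_apply B ^^ k) x)"
    by (rule norm_blinfun)
  also have "\<dots> \<le> 1 * norm x" using assms Suc by (intro mult_mono) auto
  finally show ?case by simp
qed simp

text \<open>
  The Neumann series of \<open>(I - y B)\<^sup>-\<^sup>1 u\<close>, paired with \<open>w\<close>.
\<close>
lemma resolvent_moment_series:
  fixes B :: "'a::chilbert_space \<Rightarrow>\<^sub>L 'a"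
  assumes B: "clinear_op B" "norm B \<le> 1" and y: "cmod y < 1"
    and v: "v - y *\<^sub>C blinfun_apply B v = u"
  shows "(\<lambda>k. cinner ((blinfun_apply B ^^ k) u) w * y ^ k) sums cinner v w"
proof -
  have pow: "(blinfun_apply B ^^ k) u =
      (blinfun_apply B ^^ k) v - y *\<^sub>C (blinfun_apply B ^^ Suc k) v" for k
    by (induction k) (simp_all add: v[symmetric] blinfun.diff_right clinear_opD[OF B(1)])
  have part: "(\<Sum>k<m. cinner ((blinfun_apply B ^^ k) u) w * y ^ k) =
      cinner v w - cinner ((blinfun_apply B ^^ m) v) w * y ^ m" for m
    by (induction m) (simp_all add: pow cinner_diff_left cinner_scaleC_left algebra_simps)
  have "((\<lambda>m. cinner ((blinfun_apply B ^^ m) v) w * y ^ m) \<longlonglongrightarrow> 0)"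
  proof (rule Lim_null_comparison)
    show "\<forall>\<^sub>F m in sequentially. cmod (cinner ((blinfun_apply B ^^ m) v) w * y ^ m) \<le>
        norm v * norm w * cmod y ^ m"
      by (intro always_eventually allI)
        (auto simp: norm_mult norm_power intro!: mult_right_mono
          order_trans[OF norm_cinner_le] norm_funpow_le B)
    have "(\<lambda>m. norm v * norm w * cmod y ^ m) \<longlonglongrightarrow> norm v * norm w * 0"
      by (intro tendsto_intros LIMSEQ_power_zero) (use y in auto)
    then show "(\<lambda>m. norm v * norm w * cmod y ^ m) \<longlonglongrightarrow> 0" by simp
  qed
  then have "(\<lambda>m. cinner v w - cinner ((blinfun_apply B ^^ m) v) w * y ^ m) \<longlonglongrightarrow> cinner v w - 0"
    by (intro tendsto_intros)
  then show ?thesis by (simp add: sums_def part)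
qed

text \<open>
  Let \<open>b k = \<langle>B\<^sup>k e, e\<rangle>\<close>. Expanding both sides of \<open>\<langle>B v, e\<rangle> = y\<^bsup>n-1\<^esup> \<langle>v, e\<rangle>\<close> in powers of \<open>y\<close>
  and comparing the coefficients of \<open>y\<^bsup>n-1\<^esup>\<close> gives \<open>b n = b 0 = 1\<close>. For a contraction this is the
  equality case of the Cauchy-Schwarz inequality, so \<open>B\<^sup>n e = e\<close>.
\<close>
lemma power_fixes_simple_eigenvector:
  fixes T B S :: "'a::chilbert_space \<Rightarrow>\<^sub>L 'a"
  assumes T: "clinear_op T" and B: "clinear_op B" "norm B \<le> 1" and S: "clinear_op S"
    and e: "norm e = 1" "blinfun_apply T e = e" "\<And>x. cinner (blinfun_apply T x) e = cinner x e"
    and S1: "\<And>x. blinfun_apply S x - blinfun_apply T (blinfun_apply S x) = x - cinner x e *\<^sub>C e"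
    and S2: "\<And>x. blinfun_apply S (x - blinfun_apply T x) = x - cinner x e *\<^sub>C e"
    and n: "n \<ge> 1" and "\<epsilon> > 0"
    and sing: "\<And>x y z. cmod (x - 1) < \<epsilon> \<Longrightarrow> cmod y < \<epsilon> \<Longrightarrow> cmod z < \<epsilon> \<Longrightarrow>
      x ^ n + y ^ n + (- 1) ^ (n - 1) * z ^ n = 1 \<Longrightarrow>
      \<not> invertible_op (x *\<^sub>O T + y *\<^sub>O B + z *\<^sub>O (T o\<^sub>L B) - id_blinfun)"
  shows "(blinfun_apply B ^^ n) e = e"
proof -
  define b where "b k = cinner ((blinfun_apply B ^^ k) e) e" for k
  \<comment> \<open>The coefficients of \<open>y\<^bsup>n-1\<^esup> \<langle>v, e\<rangle>\<close>.\<close>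
  define d where "d k = (if k < n - 1 then 0 else b (k - (n - 1)))" for k
  have "b (Suc k) - d k = 0" for k
  proof (rule vanishing_power_series[where r = "min \<epsilon> 1" and c = "\<lambda>k. b (Suc k) - d k"])
    show "min \<epsilon> 1 > 0" using \<open>\<epsilon> > 0\<close> by simp
    fix y :: complex assume "y \<noteq> 0" "cmod y < min \<epsilon> 1"
    then have y: "cmod y < \<epsilon>" "cmod y < 1" by auto
    have "invertible_op (id_blinfun - y *\<^sub>O B)"
      by (rule invertible_op_id_minus_scaleC[OF B y(2)])
    then obtain R where "\<And>x. blinfun_apply (id_blinfun - y *\<^sub>O B) (blinfun_apply R x) = x"
      using invertible_opE by metis
    then have v: "blinfun_apply R e - y *\<^sub>C blinfun_apply B (blinfun_apply R e) = e"
      by (simp add: blinfun.diff_left)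
    define v where "v = blinfun_apply R e"
    note v = v[folded v_def]
    have Bv: "blinfun_apply B v - y *\<^sub>C blinfun_apply B (blinfun_apply B v) = blinfun_apply B e"
      by (subst v[symmetric]) (simp add: blinfun.diff_right clinear_opD[OF B(1)])
    have 1: "(\<lambda>k. b k * y ^ k) sums cinner v e"
      unfolding b_def by (rule resolvent_moment_series[OF B y(2) v])
    have 2: "(\<lambda>k. b (Suc k) * y ^ k) sums cinner (blinfun_apply B v) e"
      using resolvent_moment_series[OF B y(2) Bv, of e]
      by (simp add: b_def funpow_swap1)
    have "(\<lambda>k. y ^ (n - 1) * (b k * y ^ k)) sums (y ^ (n - 1) * cinner v e)"
      by (rule sums_mult[OF 1])
    then have "(\<lambda>k. d (k + (n - 1)) * y ^ (k + (n - 1))) sums (y ^ (n - 1) * cinner v e)"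
      by (simp add: d_def power_add mult_ac)
    then have 3: "(\<lambda>k. d k * y ^ k) sums (y ^ (n - 1) * cinner v e)"
      using sums_iff_shift[of "\<lambda>k. d k * y ^ k" "n - 1" "y ^ (n - 1) * cinner v e"]
      by (simp add: d_def)
    have "cinner (blinfun_apply B v) e = y ^ (n - 1) * cinner v e"
      by (rule resolvent_relation_at_simple_eigenvalue[OF T B S e S1 S2 n \<open>\<epsilon> > 0\<close> sing y v])
    then show "(\<lambda>k. (b (Suc k) - d k) * y ^ k) sums 0"
      using sums_diff[OF 2 3] by (simp add: algebra_simps)
  qed
  from this[of "n - 1"] have "b n = b 0" using n by (simp add: d_def)
  then have bn: "cinner ((blinfun_apply B ^^ n) e) e = 1" using e by (simp add: b_def cinner_self)
  define w where "w = (blinfun_apply B ^^ n) e"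
  have "inner w e = 1" using bn by (simp add: w_def flip: Re_cinner)
  moreover have "norm w \<le> 1" using norm_funpow_le[OF B(2), of n e] e by (simp add: w_def)
  then have "inner w w \<le> 1" by (simp add: power_le_one flip: power2_norm_eq_inner)
  ultimately have "inner (w - e) (w - e) \<le> 0"
    using e by (simp add: inner_diff inner_commute norm_eq_1)
  then have "w - e = 0" using inner_gt_zero_iff[of "w - e"] by linarith
  then show ?thesis by (simp add: w_def)
qed

section \<open>Decomposition into eigenvectors of a cyclic operator\<close>

lemma sum_inverse_powers_roots_of_unity:
  assumes "i < n"
  shows "(\<Sum>z | z ^ n = (1::complex). (1 / z) ^ i) = (if i = 0 then of_nat n else 0)"
proof -
  have n: "n > 0" using assms by simp
  define \<zeta> where "\<zeta> = exp (2 * of_real pi * \<i> / of_nat n)"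
  have pow: "exp (2 * of_real pi * \<i> * of_nat j / of_nat n) = \<zeta> ^ j" for j
    by (simp add: \<zeta>_def mult_ac flip: exp_of_nat_mult)
  have bij: "bij_betw (\<lambda>j. \<zeta> ^ j) {..<n} {z. z ^ n = 1}"
    using bij_betw_roots_unity[of n] complex_roots_unity[of n] n by (simp add: pow)
  then have "\<zeta> \<in> {z. z ^ n = 1}" if "n > 1" using that bij_betwE[OF bij] by (metis lessThan_iff power_one_right)
  then have \<zeta>n: "\<zeta> ^ n = 1" using n by (cases "n = 1") (auto simp: \<zeta>_def)
  have "(\<Sum>z | z ^ n = 1. (1 / z) ^ i) = (\<Sum>j<n. (1 / \<zeta> ^ j) ^ i)"
    by (rule sum.reindex_bij_betw[OF bij, symmetric])
  also have "\<dots> = (\<Sum>j<n. (1 / \<zeta> ^ i) ^ j)"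
    by (simp add: power_divide mult.commute flip: power_mult)
  also have "\<dots> = (if i = 0 then of_nat n else 0)"
  proof (cases "i = 0")
    case False
    then have "\<zeta> ^ i \<noteq> \<zeta> ^ 0" using inj_onD[OF bij_betw_imp_inj_on[OF bij], of i 0] assms n by auto
    moreover have "(1 / \<zeta> ^ i) ^ n = 1"
    proof -
      have "(\<zeta> ^ i) ^ n = (\<zeta> ^ n) ^ i" by (simp add: mult.commute flip: power_mult)
      then show ?thesis by (simp add: power_one_over \<zeta>n)
    qed
    ultimately show ?thesis using False by (simp add: geometric_sum)
  qed simp
  finally show ?thesis .
qed

lemma root_of_unity_image:
  assumes "n \<ge> 1"
  shows "root_of_unity n ` {..<n} = {z. z ^ n = 1}"
  unfolding complex_roots_unity[OF assms] root_of_unity_def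
  by (auto simp: mult_ac image_iff)

lemma card_roots_of_unity: "n \<ge> 1 \<Longrightarrow> card {z::complex. z ^ n = 1} = n \<and> finite {z::complex. z ^ n = 1}"
  using card_complex_roots_unity finite_roots_unity by blast

text \<open>
  If \<open>B\<^sup>n e = e\<close>, then \<open>g\<close> is (up to the factor \<open>n\<close>) the component of \<open>e\<close> in the eigenspace of
  \<open>B\<close> for \<open>z\<close>: applying \<open>B\<close> shifts the cyclic sequence of summands and multiplies it by \<open>z\<close>.
\<close>
lemma eigencomponent:
  fixes B :: "'a::chilbert_space \<Rightarrow>\<^sub>L 'a"
  assumes B: "clinear_op B" and z: "z ^ n = 1" "n \<ge> 1" and e: "(blinfun_apply B ^^ n) e = e"
  defines "g \<equiv> \<Sum>i<n. (1 / z) ^ i *\<^sub>C (blinfun_apply B ^^ i) e"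
  shows "blinfun_apply B g = z *\<^sub>C g"
proof -
  have z0: "z \<noteq> 0" using z by (metis not_one_le_zero power_0_left zero_neq_one)
  define h where "h i = (1 / z) ^ i *\<^sub>C (blinfun_apply B ^^ i) e" for i
  have hn: "h n = h 0" using z e by (simp add: h_def power_one_over scaleC_one)
  have "blinfun_apply B (h i) = z *\<^sub>C h (Suc i)" for i
    using z0 by (simp add: h_def clinear_opD[OF B] scaleC_scaleC)
  then have "blinfun_apply B g = (\<Sum>i<n. z *\<^sub>C h (Suc i))"
    unfolding g_def h_def[symmetric] by (simp add: blinfun.sum_right)
  also have "\<dots> = z *\<^sub>C (\<Sum>i<n. h (Suc i))"
    by (simp add: complex_vector.scale_sum_right)
  also have "(\<Sum>i<n. h (Suc i)) = (\<Sum>i<n. h i)"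
    using sum.lessThan_Suc_shift[of h n] hn by simp
  finally show ?thesis by (simp add: g_def h_def)
qed

text \<open>
  By orthogonality of the characters only the summand \<open>i = 0\<close> survives. With \<open>x i = B\<^sup>i e\<close> this
  recovers \<open>e\<close> from its eigencomponents.
\<close>
lemma eigencomponents_sum:
  fixes x :: "nat \<Rightarrow> 'a::chilbert_space"
  shows "(\<Sum>z | z ^ n = 1. \<Sum>i<n. (1 / z) ^ i *\<^sub>C x i) = of_nat n *\<^sub>C x 0"
proof -
  have "(\<Sum>z | z ^ n = 1. \<Sum>i<n. (1 / z) ^ i *\<^sub>C x i) = (\<Sum>i<n. \<Sum>z | z ^ n = 1. (1 / z) ^ i *\<^sub>C x i)"
    by (rule sum.swap)
  also have "\<dots> = (\<Sum>i<n. (if i = 0 then of_nat n else 0) *\<^sub>C x i)"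
    by (rule sum.cong) (simp_all add: sum_inverse_powers_roots_of_unity flip: complex_vector.scale_sum_left)
  also have "\<dots> = of_nat n *\<^sub>C x 0"
    by (cases n) (simp_all only: sum.lessThan_Suc_shift, simp_all)
  finally show ?thesis .
qed

lemma orthonormal_independent:
  fixes e :: "'i \<Rightarrow> 'a::chilbert_space"
  assumes unit: "\<And>i. i \<in> I \<Longrightarrow> norm (e i) = 1"
    and orth: "\<And>i j. i \<in> I \<Longrightarrow> j \<in> I \<Longrightarrow> i \<noteq> j \<Longrightarrow> cinner (e i) (e j) = 0"
  shows "complex_vector.independent (e ` I)" "inj_on e I"
proof -
  have ee: "cinner (e i) (e i) = 1" if "i \<in> I" for i using unit[OF that] by (simp add: cinner_self)
  show "inj_on e I"
    by (rule inj_onI) (metis ee orth zero_neq_one)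
  have "e j \<notin> complex_vector.span (e ` I - {e j})" if j: "j \<in> I" for j
  proof
    assume "e j \<in> complex_vector.span (e ` I - {e j})"
    then have "cinner (e j) (e j) = 0"
    proof (rule complex_vector.span_induct[where P = "\<lambda>x. cinner x (e j) = 0"])
      show "complex_vector.subspace {x. cinner x (e j) = 0}"
        by (rule complex_vector.subspaceI) (auto simp: cinner_add_left cinner_scaleC_left)
      fix x assume "x \<in> e ` I - {e j}"
      then show "cinner x (e j) = 0" using orth j by auto
    qed
    then show False using ee[OF j] by simp
  qed
  then show "complex_vector.independent (e ` I)"
    unfolding complex_vector.dependent_def by auto
qed

lemma clinear_op_span_subset:
  fixes T :: "'a::chilbert_space \<Rightarrow>\<^sub>L 'a"
  assumes T: "clinear_op T" and V: "complex_vector.subspace V"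
    and X: "\<And>x. x \<in> X \<Longrightarrow> blinfun_apply T x \<in> V" and "x \<in> complex_vector.span X"
  shows "blinfun_apply T x \<in> V"
  using assms(4)
proof (rule complex_vector.span_induct[of x X "\<lambda>x. blinfun_apply T x \<in> V"])
  show "complex_vector.subspace {x. blinfun_apply T x \<in> V}"
    using V by (auto simp: complex_vector.subspace_def blinfun.add_right clinear_opD[OF T])
qed (rule X)

lemma funpow_fixed_on_span:
  fixes T :: "'a::chilbert_space \<Rightarrow>\<^sub>L 'a"
  assumes T: "clinear_op T" and X: "\<And>x. x \<in> X \<Longrightarrow> (blinfun_apply T ^^ n) x = x"
    and "x \<in> complex_vector.span X"
  shows "(blinfun_apply T ^^ n) x = x"
proof -
  have add: "(blinfun_apply T ^^ k) (x + y) = (blinfun_apply T ^^ k) x + (blinfun_apply T ^^ k) y" for k x y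
    by (induction k) (simp_all add: blinfun.add_right)
  have scale: "(blinfun_apply T ^^ k) (c *\<^sub>C x) = c *\<^sub>C (blinfun_apply T ^^ k) x" for k c x
    by (induction k) (simp_all add: clinear_opD[OF T])
  have "complex_vector.subspace {x. (blinfun_apply T ^^ n) x = x}"
    using scale[of n 0 0] by (auto simp: complex_vector.subspace_def add scale)
  with assms(3) X show ?thesis
    using complex_vector.span_induct[of x X "\<lambda>x. (blinfun_apply T ^^ n) x = x"] by auto
qed

lemma eigenvector_funpow:
  fixes T :: "'a::chilbert_space \<Rightarrow>\<^sub>L 'a"
  assumes T: "clinear_op T" and v: "blinfun_apply T v = c *\<^sub>C v"
  shows "(blinfun_apply T ^^ n) v = c ^ n *\<^sub>C v"
  by (induction n) (simp_all add: v clinear_opD[OF T] scaleC_scaleC scaleC_one mult.commute)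

lemma image_eq_of_finite_order:
  fixes T :: "'a::chilbert_space \<Rightarrow>\<^sub>L 'a"
  assumes inv: "blinfun_apply T ` V \<subseteq> V" and "n \<ge> 1"
    and per: "\<And>x. x \<in> V \<Longrightarrow> (blinfun_apply T ^^ n) x = x"
  shows "blinfun_apply T ` V = V"
proof
  show "V \<subseteq> blinfun_apply T ` V"
  proof
    fix x assume x: "x \<in> V"
    have "(blinfun_apply T ^^ k) x \<in> V" for k using inv x by (induction k) auto
    moreover have "x = blinfun_apply T ((blinfun_apply T ^^ (n - 1)) x)"
      using per[OF x] \<open>n \<ge> 1\<close> by (cases n) auto
    ultimately show "x \<in> blinfun_apply T ` V" by blast
  qed
qed (rule inv)

lemma isometric_on_subspace_preserves_cinner:
  fixes T :: "'a::chilbert_space \<Rightarrow>\<^sub>L 'a"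
  assumes T: "clinear_op T" and V: "complex_vector.subspace V"
    and iso: "\<And>x. x \<in> V \<Longrightarrow> norm (blinfun_apply T x) = norm x" and uv: "u \<in> V" "v \<in> V"
  shows "cinner (blinfun_apply T u) (blinfun_apply T v) = cinner u v"
proof -
  have re: "inner (blinfun_apply T x) (blinfun_apply T z) = inner x z" if "x \<in> V" "z \<in> V" for x z
    using iso[of "x + z"] iso that complex_vector.subspace_add[OF V that]
    by (simp add: dot_norm flip: blinfun.add_right)
  have im: "Im (cinner x z) = - inner (\<i> *\<^sub>C x) z" for x z :: 'a
    by (simp add: cinner_scaleC_left flip: Re_cinner)
  have "\<i> *\<^sub>C u \<in> V" using complex_vector.subspace_scale[OF V] uv by blast
  then show ?thesis
    using re[OF _ uv(2)] uv by (simp add: complex_eq_iff Re_cinner im flip: clinear_opD[OF T])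
qed

text \<open>
  The chain \<open>\<parallel>x\<parallel> = \<parallel>T\<^sup>n x\<parallel> \<le> \<parallel>T x\<parallel> \<le> \<parallel>x\<parallel>\<close> consists of equalities.
\<close>
lemma contraction_of_finite_order_unitary_on:
  fixes T :: "'a::chilbert_space \<Rightarrow>\<^sub>L 'a"
  assumes T: "clinear_op T" "norm T \<le> 1" and V: "complex_vector.subspace V"
    and inv: "blinfun_apply T ` V \<subseteq> V" and n: "n \<ge> 1"
    and per: "\<And>x. x \<in> V \<Longrightarrow> (blinfun_apply T ^^ n) x = x"
  shows "unitary_on V T"
proof -
  have "norm (blinfun_apply T x) = norm x" if x: "x \<in> V" for x
  proof (rule antisym)
    show "norm (blinfun_apply T x) \<le> norm x" using norm_funpow_le[OF T(2), of 1 x] by simp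
    have "(blinfun_apply T ^^ n) x = (blinfun_apply T ^^ (n - 1)) (blinfun_apply T x)"
      using n by (cases n) (simp_all add: funpow_swap1)
    then have "x = (blinfun_apply T ^^ (n - 1)) (blinfun_apply T x)" using per[OF x] by simp
    then show "norm x \<le> norm (blinfun_apply T x)"
      using norm_funpow_le[OF T(2), of "n - 1" "blinfun_apply T x"] by simp
  qed
  then show ?thesis
    unfolding unitary_on_def
    using image_eq_of_finite_order[OF inv n per] isometric_on_subspace_preserves_cinner[OF T(1) V]
    by blast
qed

section \<open>The common invariant subspace\<close>

text \<open>
  The components of each \<open>e z\<close> in the eigenspaces of \<open>B\<close> are multiples of the vectors \<open>f w\<close>, so
  all \<open>e z\<close> lie in the span of the \<open>f w\<close>. There are at most \<open>n\<close> vectors \<open>f w\<close>, while the \<open>n\<close> vectors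
  \<open>e z\<close> are orthonormal; hence the two spans agree. One description makes \<open>L\<close> invariant under
  \<open>A\<close>, the other under \<open>B\<close>.
\<close>
lemma span_of_cyclic_eigenvectors:
  fixes A B :: "'a::chilbert_space \<Rightarrow>\<^sub>L 'a" and e f :: "complex \<Rightarrow> 'a"
  assumes A: "clinear_op A" "normal_op A" and B: "clinear_op B" "norm B \<le> 1" and n: "n \<ge> 1"
    and e: "\<And>z. z ^ n = 1 \<Longrightarrow> norm (e z) = 1"
      "\<And>z. z ^ n = 1 \<Longrightarrow> blinfun_apply A (e z) = z *\<^sub>C e z"
      "\<And>z. z ^ n = 1 \<Longrightarrow> (blinfun_apply B ^^ n) (e z) = e z"
    and f: "\<And>z. z ^ n = 1 \<Longrightarrow> blinfun_apply B (f z) = z *\<^sub>C f z"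
      "\<And>z x. z ^ n = 1 \<Longrightarrow> blinfun_apply B x = z *\<^sub>C x \<Longrightarrow> \<exists>a. x = a *\<^sub>C f z"
  defines "L \<equiv> complex_vector.span (e ` {z. z ^ n = 1})"
  shows "complex_vector.dim L = n" "blinfun_apply B ` L \<subseteq> L" "unitary_on L B" "unitary_on L A"
proof -
  define U where "U = {z::complex. z ^ n = 1}"
  define E where "E = e ` U"
  define F where "F = f ` U"
  have L: "L = complex_vector.span E" by (simp add: L_def E_def U_def)
  have U: "finite U" "card U = n" using card_roots_of_unity[OF n] by (simp_all add: U_def)
  have V: "complex_vector.subspace L" unfolding L by (rule complex_vector.subspace_span)
  obtain Q where Q: "is_adjoint Q A" "A o\<^sub>L Q = Q o\<^sub>L A"
    using A(2) unfolding normal_op_def by blast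
  have Qe: "blinfun_apply Q (e z) = cnj z *\<^sub>C e z" if "z \<in> U" for z
    by (rule adjoint_eigenvector[OF Q e(2)]) (use that in \<open>simp add: U_def\<close>)
  have adj: "cinner (blinfun_apply A x) y = cinner x (blinfun_apply Q y)" for x y
    using Q(1) by (simp add: is_adjoint_def)
  have orth: "cinner (e z) (e w) = 0" if "z \<in> U" "w \<in> U" "z \<noteq> w" for z w
  proof -
    have "z * cinner (e z) (e w) = w * cinner (e z) (e w)"
      using adj[of "e z" "e w"] e(2)[of z] Qe[of w] that
      by (simp add: U_def cinner_scaleC_left cinner_scaleC_right)
    then show ?thesis using that by simp
  qed
  have indep: "complex_vector.independent E" and inj: "inj_on e U"
    unfolding E_def by (rule orthonormal_independent; use e(1) orth U_def in auto)+
  have cardE: "card E = n" "finite E" using card_image[OF inj] U by (simp_all add: E_def)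
  show "complex_vector.dim L = n"
    unfolding L using complex_vector.dim_span_eq_card_independent[OF indep] cardE by simp
  have F: "finite F" "card F \<le> n" using U card_image_le[OF U(1), of f] by (auto simp: F_def)
  have EF: "e w \<in> complex_vector.span F" if w: "w \<in> U" for w
  proof -
    define g where "g z = (\<Sum>i<n. (1 / z) ^ i *\<^sub>C (blinfun_apply B ^^ i) (e w))" for z
    have "g z \<in> complex_vector.span F" if z: "z \<in> U" for z
    proof -
      have "blinfun_apply B (g z) = z *\<^sub>C g z"
        unfolding g_def by (rule eigencomponent[OF B(1) _ n e(3)]) (use z w in \<open>simp_all add: U_def\<close>)
      then obtain a where "g z = a *\<^sub>C f z" using f(2) z by (auto simp: U_def)
      moreover have "f z \<in> complex_vector.span F"
        using z by (auto simp: F_def intro: complex_vector.span_base)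
      ultimately show ?thesis by (simp add: complex_vector.span_scale)
    qed
    then have "(\<Sum>z\<in>U. g z) \<in> complex_vector.span F" by (rule complex_vector.span_sum)
    then have "of_nat n *\<^sub>C e w \<in> complex_vector.span F"
      unfolding g_def U_def eigencomponents_sum by simp
    then have "(1 / of_nat n) *\<^sub>C of_nat n *\<^sub>C e w \<in> complex_vector.span F"
      by (rule complex_vector.span_scale)
    then show ?thesis using n by (simp add: scaleC_scaleC scaleC_one)
  qed
  \<comment> \<open>A vector of \<open>F\<close> outside \<open>L\<close> would extend \<open>E\<close> to \<open>n + 1\<close> independent vectors in the span of
    the at most \<open>n\<close> vectors of \<open>F\<close>.\<close>
  have FE: "F \<subseteq> L"
  proof (rule ccontr)
    assume "\<not> F \<subseteq> L"
    then obtain x where x: "x \<in> F" "x \<notin> complex_vector.span E" unfolding L by blast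
    then have "complex_vector.independent (insert x E)"
      using indep by (simp add: complex_vector.independent_insert)
    moreover have "insert x E \<subseteq> complex_vector.span F"
      using EF x by (auto simp: E_def intro: complex_vector.span_base)
    ultimately have "card (insert x E) \<le> card F"
      using complex_vector.independent_span_bound[OF F(1)] by blast
    moreover have "x \<notin> E" using x(2) complex_vector.span_base by blast
    ultimately show False using cardE F by simp
  qed
  have LF: "L \<subseteq> complex_vector.span F"
    unfolding L by (rule complex_vector.span_minimal) (use EF in \<open>auto simp: E_def\<close>)
  show BL: "blinfun_apply B ` L \<subseteq> L"
  proof
    fix y assume "y \<in> blinfun_apply B ` L"
    then obtain x where x: "x \<in> complex_vector.span F" "y = blinfun_apply B x" using LF by auto
    have "blinfun_apply B v \<in> L" if "v \<in> F" for v
    proof -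
      obtain z where z: "z \<in> U" "v = f z" using \<open>v \<in> F\<close> by (auto simp: F_def)
      then have "blinfun_apply B v = z *\<^sub>C v" using f(1) by (simp add: U_def)
      then show ?thesis using that FE complex_vector.subspace_scale[OF V] by auto
    qed
    then show "y \<in> L" unfolding x(2) by (rule clinear_op_span_subset[OF B(1) V _ x(1)])
  qed
  show "unitary_on L B"
  proof (rule contraction_of_finite_order_unitary_on[OF B V BL n])
    fix x assume x: "x \<in> L"
    have fixE: "(blinfun_apply B ^^ n) v = v" if "v \<in> E" for v
      using that e(3) unfolding E_def U_def by blast
    show "(blinfun_apply B ^^ n) x = x"
      by (rule funpow_fixed_on_span[OF B(1) fixE x[unfolded L]])
  qed
  have AL: "blinfun_apply A ` L \<subseteq> L"
  proof
    fix y assume "y \<in> blinfun_apply A ` L"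
    then obtain x where x: "x \<in> complex_vector.span E" "y = blinfun_apply A x" unfolding L by auto
    have "blinfun_apply A v \<in> L" if "v \<in> E" for v
    proof -
      obtain z where z: "z \<in> U" "v = e z" using \<open>v \<in> E\<close> by (auto simp: E_def)
      then have "blinfun_apply A v = z *\<^sub>C v" using e(2) by (simp add: U_def)
      then show ?thesis using that complex_vector.subspace_scale[OF V] complex_vector.span_base L by metis
    qed
    then show "y \<in> L" unfolding x(2) by (rule clinear_op_span_subset[OF A(1) V _ x(1)])
  qed
  have "(blinfun_apply A ^^ n) x = x" if "x \<in> L" for x
  proof (rule funpow_fixed_on_span[OF A(1)])
    fix v assume "v \<in> E"
    then obtain z where z: "z ^ n = 1" "v = e z" by (auto simp: E_def U_def)
    show "(blinfun_apply A ^^ n) v = v"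
      unfolding z(2) eigenvector_funpow[OF A(1) e(2)[OF z(1)]] z(1) by (rule scaleC_one)
  qed (use that L in simp)
  then have "blinfun_apply A ` L = L" by (rule image_eq_of_finite_order[OF AL n])
  \<comment> \<open>The adjoint inverts \<open>A\<close> on \<open>L\<close>, because the eigenvalues are unimodular.\<close>
  moreover have QA: "blinfun_apply Q (blinfun_apply A x) = x" if "x \<in> L" for x
  proof -
    have cQ: "clinear_op Q" by (rule clinear_op_adjoint[OF Q(1)])
    have unim: "cnj z * z = 1" if "z \<in> U" for z
    proof -
      have "cmod z = 1" using n that power_eq_1_iff[of z n] by (auto simp: U_def)
      then show ?thesis using complex_norm_square[of z] by (simp add: mult.commute)
    qed
    have "(blinfun_apply (Q o\<^sub>L A) ^^ 1) x = x"
    proof (rule funpow_fixed_on_span[where X = E])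
      fix v assume "v \<in> E"
      then obtain z where z: "z \<in> U" "v = e z" by (auto simp: E_def)
      then have "blinfun_apply A v = z *\<^sub>C v" "blinfun_apply Q v = cnj z *\<^sub>C v"
        using e(2) Qe by (simp_all add: U_def)
      then show "(blinfun_apply (Q o\<^sub>L A) ^^ 1) v = v"
        using unim[OF z(1)] by (simp add: clinear_opD[OF cQ] scaleC_scaleC scaleC_one mult.commute)
    qed (use that L in \<open>auto intro: clinear_op_compose cQ A\<close>)
    then show ?thesis by simp
  qed
  ultimately show "unitary_on L A"
    unfolding unitary_on_def by (simp add: adj)
qed

lemma pencil_triple:
  fixes A B C :: "'a::chilbert_space \<Rightarrow>\<^sub>L 'a" and p :: "complex ^ 3"
  shows "pencil (vector [A, B, C]) p = p $ 1 *\<^sub>O A + p $ 2 *\<^sub>O B + p $ 3 *\<^sub>O C"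
  by (simp add: pencil_def sum_3)

lemma zero_scaleC_op [simp]: "0 *\<^sub>O T = 0"
  by (rule blinfun_eqI) simp

lemma polydisk_vector:
  "vector [x, y, z] \<in> polydisk (vector [a, b, c] :: complex ^ 3) \<epsilon> \<longleftrightarrow>
    cmod (x - a) < \<epsilon> \<and> cmod (y - b) < \<epsilon> \<and> cmod (z - c) < \<epsilon>"
  by (simp add: polydisk_def forall_3)

theorem theorem1p16:
  fixes A B :: "'a::chilbert_space \<Rightarrow>\<^sub>L 'a"
    and n :: nat and \<epsilon> :: real and L :: "'a set"
  assumes "L = complex_vector.span (\<Union>m<n. eigenvectors A (root_of_unity n m))"
    and "clinear_op A" and "clinear_op B"
    and "normal_op A" and "norm B = 1"
    and "n \<ge> 1" and "\<epsilon> > 0"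
    and "\<And>j \<tau>. j < n \<Longrightarrow> \<tau> \<in> {tau1 n j, tau2 n j} \<Longrightarrow>
      sigma_p (vector [A, B, A o\<^sub>L B]) \<inter> polydisk \<tau> \<epsilon> = Gamma_surface n \<inter> polydisk \<tau> \<epsilon>"
    and "\<And>j \<tau> x. j < n \<Longrightarrow> \<tau> \<in> {tau1 n j, tau2 n j} \<Longrightarrow>
      x \<in> sigma_p (vector [A, B, A o\<^sub>L B] :: ('a \<Rightarrow>\<^sub>L 'a) ^ 3) \<inter> polydisk \<tau> \<epsilon> \<Longrightarrow>
      multiplicity_one (vector [A, B, A o\<^sub>L B]) x"
  shows "complex_vector.dim L = n \<and> blinfun_apply B ` L \<subseteq> L \<and>
    unitary_on L B \<and> unitary_on L A"
proof -
  note A = assms(2) and B = assms(3) and n = assms(6)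
  have B1: "norm B \<le> 1" using assms(5) by simp
  define U where "U = {z::complex. z ^ n = 1}"
  let ?ops = "vector [A, B, A o\<^sub>L B] :: ('a \<Rightarrow>\<^sub>L 'a) ^ 3"
  have U: "root_of_unity n ` {..<n} = U" using root_of_unity_image[OF n] by (simp add: U_def)
  have inverse_root: "\<exists>j<n. root_of_unity n j = 1 / z" if "z \<in> U" for z
  proof -
    have "1 / z \<in> U" using that by (simp add: U_def power_one_over)
    then show ?thesis using U by (metis image_iff lessThan_iff)
  qed
  have nonzero: "z \<noteq> 0" if "z \<in> U" for z
    using that n by (auto simp: U_def power_0_left)
  have mult: "multiplicity_one ?ops \<tau>" if "j < n" "\<tau> \<in> {tau1 n j, tau2 n j}" for j \<tau>
  proof (rule assms(9)[OF that])
    have "root_of_unity n j ^ n = 1" using U that(1) by (auto simp: U_def)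
    then have "\<tau> \<in> Gamma_surface n \<inter> polydisk \<tau> \<epsilon>"
      using that(2) n \<open>\<epsilon> > 0\<close>
      by (auto simp: Gamma_surface_def tau1_def tau2_def polydisk_def power_0_left)
    then show "\<tau> \<in> sigma_p ?ops \<inter> polydisk \<tau> \<epsilon>" using assms(8)[OF that] by simp
  qed
  have "\<exists>e. norm e = 1 \<and> blinfun_apply A e = z *\<^sub>C e \<and> (blinfun_apply B ^^ n) e = e \<and>
      (\<forall>x. blinfun_apply A x = z *\<^sub>C x \<longrightarrow> (\<exists>a. x = a *\<^sub>C e))" if z: "z \<in> U" for z
  proof -
    obtain j where j: "j < n" "root_of_unity n j = 1 / z" using inverse_root[OF z] by blast
    \<comment> \<open>Replacing \<open>A\<close> by \<open>T = c A\<close> moves the eigenvalue to \<open>1\<close>; the surface is invariant under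
      multiplying the first and third coordinates by \<open>c\<close>, as \<open>c\<^sup>n = 1\<close>.\<close>
    define c where "c = 1 / z"
    have c: "c ^ n = 1" "c \<noteq> 0" "cmod c = 1"
    proof -
      show "c ^ n = 1" using z by (simp add: c_def U_def power_one_over)
      then show "cmod c = 1" using n power_eq_1_iff[of c n] by auto
      then show "c \<noteq> 0" by auto
    qed
    define T where "T = c *\<^sub>O A"
    have T: "clinear_op T" "normal_op T"
      unfolding T_def by (intro clinear_op_scaleC normal_op_scaleC A assms(4))+
    have tau: "tau1 n j = vector [c, 0, 0]" using j by (simp add: tau1_def c_def)
    have pencil: "pencil ?ops (tau1 n j) = T" by (simp add: pencil_triple tau T_def)
    have m1: "1 isolated_in spectrum_op T"
      "\<forall>\<^sub>F \<rho> in at_right 0. complex_vector.dim (range (blinfun_apply (riesz_projection T 1 \<rho>))) = 1"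
      using mult[OF j(1), of "tau1 n j"] unfolding multiplicity_one_def pencil by auto
    obtain e S where e: "norm e = 1" "blinfun_apply T e = 1 *\<^sub>C e" "clinear_op S"
      "\<And>x. cinner (blinfun_apply T x) e = 1 * cinner x e"
      "\<And>x. 1 *\<^sub>C blinfun_apply S x - blinfun_apply T (blinfun_apply S x) = x - cinner x e *\<^sub>C e"
      "\<And>x. blinfun_apply S (1 *\<^sub>C x - blinfun_apply T x) = x - cinner x e *\<^sub>C e"
      by (rule normal_simple_spectral_point[OF T m1]) (rule that; blast)
    note e' = e[unfolded scaleC_one mult_1_left]
    have "(blinfun_apply B ^^ n) e = e"
    proof (rule power_fixes_simple_eigenvector[OF T(1) B B1 e'(3) e'(1,2) e'(4,5,6) n \<open>\<epsilon> > 0\<close>])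
      fix x y w assume le: "cmod (x - 1) < \<epsilon>" "cmod y < \<epsilon>" "cmod w < \<epsilon>"
        and on: "x ^ n + y ^ n + (- 1) ^ (n - 1) * w ^ n = 1"
      define p where "p = (vector [x * c, y, w * c] :: complex ^ 3)"
      have "cmod (x * c - c) = cmod (x - 1)"
      proof -
        have "x * c - c = (x - 1) * c" by (simp add: algebra_simps)
        then show ?thesis by (simp add: norm_mult c)
      qed
      then have "p \<in> Gamma_surface n \<inter> polydisk (tau1 n j) \<epsilon>"
        using le on
        by (simp add: p_def tau polydisk_vector Gamma_surface_def power_mult_distrib c norm_mult)
      then have "p \<in> sigma_p ?ops" using assms(8)[OF j(1), of "tau1 n j"] by blast
      moreover have "pencil ?ops p = x *\<^sub>O T + y *\<^sub>O B + w *\<^sub>O (T o\<^sub>L B)"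
        by (rule blinfun_eqI) (simp add: pencil_triple p_def T_def blinfun.add_left scaleC_scaleC)
      ultimately show "\<not> invertible_op (x *\<^sub>O T + y *\<^sub>O B + w *\<^sub>O (T o\<^sub>L B) - id_blinfun)"
        by (simp add: sigma_p_def)
    qed
    moreover have "blinfun_apply A e = z *\<^sub>C e"
    proof -
      have "z *\<^sub>C blinfun_apply T e = blinfun_apply A e"
        using nonzero[OF z] by (simp add: T_def c_def scaleC_scaleC scaleC_one)
      then show ?thesis using e'(2) by simp
    qed
    moreover have "\<exists>a. x = a *\<^sub>C e" if "blinfun_apply A x = z *\<^sub>C x" for x
    proof -
      have "blinfun_apply T x = x"
        using that nonzero[OF z] by (simp add: T_def c_def scaleC_scaleC scaleC_one)
      then have "x = cinner x e *\<^sub>C e" using e'(6)[of x] by (simp add: blinfun.zero_right)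
      then show ?thesis by blast
    qed
    ultimately show ?thesis using e'(1) by blast
  qed
  then have "\<forall>z\<in>U. \<exists>e. norm e = 1 \<and> blinfun_apply A e = z *\<^sub>C e \<and> (blinfun_apply B ^^ n) e = e \<and>
      (\<forall>x. blinfun_apply A x = z *\<^sub>C x \<longrightarrow> (\<exists>a. x = a *\<^sub>C e))" by blast
  from bchoice[OF this] obtain e where e: "\<And>z. z \<in> U \<Longrightarrow> norm (e z) = 1"
    "\<And>z. z \<in> U \<Longrightarrow> blinfun_apply A (e z) = z *\<^sub>C e z"
    "\<And>z. z \<in> U \<Longrightarrow> (blinfun_apply B ^^ n) (e z) = e z"
    "\<And>z x. z \<in> U \<Longrightarrow> blinfun_apply A x = z *\<^sub>C x \<Longrightarrow> \<exists>a. x = a *\<^sub>C e z"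
    by blast
  have "\<exists>f. blinfun_apply B f = z *\<^sub>C f \<and>
      (\<forall>x. blinfun_apply B x = z *\<^sub>C x \<longrightarrow> (\<exists>a. x = a *\<^sub>C f))" if z: "z \<in> U" for z
  proof -
    obtain j where j: "j < n" "root_of_unity n j = 1 / z" using inverse_root[OF z] by blast
    define T where "T = (1 / z) *\<^sub>O B"
    have T: "clinear_op T" unfolding T_def by (intro clinear_op_scaleC B)
    have pencil: "pencil ?ops (tau2 n j) = T" by (simp add: pencil_triple tau2_def j T_def)
    have m1: "1 isolated_in spectrum_op T"
      "\<forall>\<^sub>F \<rho> in at_right 0. complex_vector.dim (range (blinfun_apply (riesz_projection T 1 \<rho>))) = 1"
      using mult[OF j(1), of "tau2 n j"] unfolding multiplicity_one_def pencil by auto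
    obtain f S \<phi> where f: "blinfun_apply T f = 1 *\<^sub>C f"
      "\<And>x. blinfun_apply S (1 *\<^sub>C x - blinfun_apply T x) = x - \<phi> x *\<^sub>C f"
      by (rule simple_spectral_point[OF T m1]) (rule that; blast)
    have "z *\<^sub>C blinfun_apply T f = blinfun_apply B f"
      using nonzero[OF z] by (simp add: T_def scaleC_scaleC scaleC_one)
    then have "blinfun_apply B f = z *\<^sub>C f" using f(1) by (simp add: scaleC_one)
    moreover have "\<exists>a. x = a *\<^sub>C f" if "blinfun_apply B x = z *\<^sub>C x" for x
    proof -
      have "blinfun_apply T x = x"
        using that nonzero[OF z] by (simp add: T_def scaleC_scaleC scaleC_one)
      then have "x = \<phi> x *\<^sub>C f" using f(2)[of x] by (simp add: scaleC_one blinfun.zero_right)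
      then show ?thesis by blast
    qed
    ultimately show ?thesis by blast
  qed
  then have "\<forall>z\<in>U. \<exists>f. blinfun_apply B f = z *\<^sub>C f \<and>
      (\<forall>x. blinfun_apply B x = z *\<^sub>C x \<longrightarrow> (\<exists>a. x = a *\<^sub>C f))" by blast
  from bchoice[OF this] obtain f where f: "\<And>z. z \<in> U \<Longrightarrow> blinfun_apply B (f z) = z *\<^sub>C f z"
    "\<And>z x. z \<in> U \<Longrightarrow> blinfun_apply B x = z *\<^sub>C x \<Longrightarrow> \<exists>a. x = a *\<^sub>C f z"
    by blast
  have "L = complex_vector.span (e ` U)"
  proof -
    have L: "L = complex_vector.span (\<Union>z\<in>U. eigenvectors A z)"
      unfolding assms(1) by (simp flip: U)
    show ?thesis
    proof
      show "L \<subseteq> complex_vector.span (e ` U)"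
        unfolding L
      proof (rule complex_vector.span_minimal)
        show "(\<Union>z\<in>U. eigenvectors A z) \<subseteq> complex_vector.span (e ` U)"
        proof
          fix x assume "x \<in> (\<Union>z\<in>U. eigenvectors A z)"
          then obtain z where z: "z \<in> U" "blinfun_apply A x = z *\<^sub>C x"
            by (auto simp: eigenvectors_def)
          then obtain a where "x = a *\<^sub>C e z" using e(4) by blast
          with z(1) show "x \<in> complex_vector.span (e ` U)"
            by (metis complex_vector.span_base complex_vector.span_scale image_eqI)
        qed
      qed (rule complex_vector.subspace_span)
      have "e z \<noteq> 0" if "z \<in> U" for z using e(1)[OF that] by auto
      then show "complex_vector.span (e ` U) \<subseteq> L"
        unfolding L by (intro complex_vector.span_mono) (auto simp: eigenvectors_def e)
    qed
  qed
  then show ?thesis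
    using span_of_cyclic_eigenvectors[OF A assms(4) B B1 n, of e f] e f unfolding U_def by auto
qed

end
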